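(* Let $n\ge1$ and let $K\subset(\mathbb{R}^{2n},\omega_0)$ be a convex polytope with $(2n-1)$-dimensional facets $\{F_i\}_{i=1}^N$. Then $$c_{\rm EHZ}(K\times_L K)\leqslant 2\min_{x\in K}\sum_{i=1}^{N}\left({\rm dist}(x,F_i)\right)^2,$$ where ${\rm dist}(x,F_i)$ is the Euclidean distance from $x$ to the hyperplane containing the facet $F_i$, and the capacity is taken in $\mathbb{R}^{2n}_q\times\mathbb{R}^{2n}_p=\mathbb{R}^{4n}$ with its standard symplectic form.
   Context: A convex polytope here is the convex hull of finitely many points with non-empty interior in $\mathbb{R}^{2n}$; $F_1,\dots,F_N$ are all of its facets. $\langle\cdot,\cdot\rangle$ is the Euclidean inner product. Symplectic form and complex structure: for $m\ge1$, $\mathbb{R}^{2m}=\mathbb{R}^m_q\times\mathbb{R}^m_p$ carries the standard symplectic form $\omega((q,p),(q',p'))=\langle q,p'\rangle-\langle p,q'\rangle$ and the standard complex structure $J_{2m}(q,p)=(-p,q)$, so that $\langle x,y\rangle_{\mathbb{R}^{2m}}=\omega(x,J_{2m}y)$. On $\mathbb{R}^{2n}$ this form is denoted $\omega_0$. Lagrangian product: for $A,B\subset\mathbb{R}^{2n}$, $A\times_L B=\{(q,p)\in\mathbb{R}^{2n}\times\mathbb{R}^{2n} : q\in A,\ p\in B\}\subset\mathbb{R}^{4n}$, where $\mathbb{R}^{4n}=\mathbb{R}^{2n}_q\times\mathbb{R}^{2n}_p$ has the standard symplectic form $\tilde\omega_0((q,p),(q',p'))=\langle q,p'\rangle_{\mathbb{R}^{2n}}-\langle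 p,q'\rangle_{\mathbb{R}^{2n}}$. Ekeland–Hofer–Zehnder capacity: for a convex body (compact convex set with non-empty interior) $C\subset(\mathbb{R}^{2m},\omega)$, $c_{\rm EHZ}(C)$ is the minimum of the action $A(\gamma)=\frac12\int_0^T\omega(\gamma(t),\dot\gamma(t))\,dt$ over all (generalized) closed characteristics on $\partial C$, i.e. non-constant absolutely continuous closed curves $\gamma:[0,T]\to\partial C$, $\gamma(0)=\gamma(T)$, with square-integrable derivative, such that $\dot\gamma(t)\in J_{2m}N_C(\gamma(t))$ for almost every $t$, where $N_C(x)=\{v:\langle v,y-x\rangle\le0\ \ \forall y\in C\}$ is the outer normal cone of $C$ at $x$. This coincides with the continuous extension (in the Hausdorff metric) to all convex bodies of the minimal action of closed characteristics on the boundary of smooth convex bodies. *)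

theory Defs
  imports "HOL-Analysis.Analysis"
begin

text \<open>
  The space \<open>\<real>\<^sup>2\<^sup>m = \<real>\<^sup>m\<^sub>q \<times> \<real>\<^sup>m\<^sub>p\<close> is rendered as \<open>'a \<times> 'a\<close> for a Euclidean space \<open>'a\<close> of
  dimension \<open>m\<close>; the inner product of the library on \<open>'a \<times> 'a\<close> is the Euclidean one.
  The space \<open>\<real>\<^sup>4\<^sup>n = \<real>\<^sup>2\<^sup>n\<^sub>q \<times> \<real>\<^sup>2\<^sup>n\<^sub>p\<close> is the instance \<open>'a = (real ^ 'n) \<times> (real ^ 'n)\<close>, so that
  \<open>sympl_form\<close> there pairs the two \<open>\<real>\<^sup>2\<^sup>n\<close> factors, and the Lagrangian product of
  \<open>A, B \<subseteq> \<real>\<^sup>2\<^sup>n\<close> is the plain product set.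
\<close>

definition sympl_form :: "'a::euclidean_space \<times> 'a \<Rightarrow> 'a \<times> 'a \<Rightarrow> real" where
  "sympl_form x y = fst x \<bullet> snd y - snd x \<bullet> fst y"

definition complex_str :: "'a::euclidean_space \<times> 'a \<Rightarrow> 'a \<times> 'a" where
  "complex_str x = (- snd x, fst x)"

lemma inner_eq_sympl_form: "x \<bullet> y = sympl_form x (complex_str y)"
  by (simp add: sympl_form_def complex_str_def inner_prod_def)

abbreviation lagrangian_product :: "'a set \<Rightarrow> 'a set \<Rightarrow> ('a \<times> 'a) set"  (infixr "\<times>\<^sub>L" 80) where
  "A \<times>\<^sub>L B \<equiv> A \<times> B"

definition outer_normal_cone :: "'a::euclidean_space set \<Rightarrow> 'a \<Rightarrow> 'a set" where
  "outer_normal_cone C x = {v. \<forall>y\<in>C. v \<bullet> (y - x) \<le> 0}"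

definition abs_continuous_on :: "real \<Rightarrow> real \<Rightarrow> (real \<Rightarrow> 'a::euclidean_space) \<Rightarrow> bool" where
  "abs_continuous_on a b f \<longleftrightarrow>
    (\<forall>\<epsilon>>0. \<exists>\<delta>>0. \<forall>(m::nat) u v.
      (\<forall>i<m. a \<le> u i \<and> u i \<le> v i \<and> v i \<le> b) \<longrightarrow>
      disjoint_family_on (\<lambda>i. {u i<..<v i}) {..<m} \<longrightarrow>
      (\<Sum>i<m. v i - u i) < \<delta> \<longrightarrow>
      (\<Sum>i<m. dist (f (u i)) (f (v i))) < \<epsilon>)"

text \<open>
  An absolutely continuous curve is differentiable almost everywhere, so the value of
  \<open>vector_derivative\<close> at the remaining points is immaterial. Differentiability is stated along with
  the inclusion all the same, so that no unspecified value enters there.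
\<close>

definition closed_characteristic ::
  "('a::euclidean_space \<times> 'a) set \<Rightarrow> real \<Rightarrow> (real \<Rightarrow> 'a \<times> 'a) \<Rightarrow> bool" where
  "closed_characteristic C T \<gamma> \<longleftrightarrow>
    0 < T \<and> \<gamma> ` {0..T} \<subseteq> frontier C \<and> \<gamma> 0 = \<gamma> T \<and> \<not> \<gamma> constant_on {0..T} \<and>
    abs_continuous_on 0 T \<gamma> \<and>
    set_integrable lebesgue {0..T} (\<lambda>t. (norm (vector_derivative \<gamma> (at t)))\<^sup>2) \<and>
    (AE t in lebesgue. t \<in> {0..T} \<longrightarrow>
      \<gamma> differentiable (at t) \<and>
      vector_derivative \<gamma> (at t) \<in> complex_str ` outer_normal_cone C (\<gamma> t))"

definition sympl_action :: "real \<Rightarrow> (real \<Rightarrow> 'a::euclidean_space \<times> 'a) \<Rightarrow> real" where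
  "sympl_action T \<gamma> =
    (1 / 2) * (LINT t:{0..T}|lebesgue. sympl_form (\<gamma> t) (vector_derivative \<gamma> (at t)))"

text \<open>
  The minimal action, written as an infimum, which equals the minimum as that is attained on a
  convex body. Extended reals are used so that no arbitrary value arises:
  were there no closed characteristic, the capacity would be \<open>\<infinity>\<close>.
\<close>

definition ehz_capacity :: "('a::euclidean_space \<times> 'a) set \<Rightarrow> ereal" where
  "ehz_capacity C = Inf {ereal (sympl_action T \<gamma>) | T \<gamma>. closed_characteristic C T \<gamma>}"

text \<open>
  A facet of a full-dimensional polytope has codimension one, so the hyperplane containing it is
  its affine hull. The sum of squared distances to these hyperplanes attains its minimum over the
  polytope, so that its \<open>INF\<close> is that minimum:
\<close>

lemma facet_dist_sum_attains_INF:
  fixes K :: "'a::euclidean_space set"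
  defines "s \<equiv> \<lambda>x. \<Sum>F | F facet_of K. (infdist x (affine hull F))\<^sup>2"
  assumes "polytope K" "K \<noteq> {}"
  shows "\<exists>x\<in>K. s x = (INF y\<in>K. s y)"
proof -
  have "continuous_on K s"
    unfolding s_def by (intro continuous_intros)
  then obtain x where x: "x \<in> K" "\<And>y. y \<in> K \<Longrightarrow> s x \<le> s y"
    using continuous_attains_inf[OF polytope_imp_compact[OF assms(2)] assms(3)] by blast
  have "(INF y\<in>K. s y) = s x"
    by (rule cInf_eq_minimum) (use x in auto)
  then show ?thesis using x(1) by auto
qed

end

theory Submission
  imports Defs
begin

text \<open>
  A polytope \<open>n\<^sub>i \<bullet> z \<le> d\<^sub>i\<close> carries closed characteristics that are polygons with velocities
  \<open>J n\<^sub>i\<close>. Among all closed words of weighted normals \<open>v\<^sub>l = t\<^sub>l n\<^bsub>i l\<^esub>\<close> with \<open>\<Sum> t\<^sub>l d\<^bsub>i l\<^esub> = 1\<close>, the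
  form \<open>\<Sum>\<^bsub>j<l\<^esub> \<omega>(v\<^sub>j, v\<^sub>l)\<close> has a maximum \<open>q\<close>: repeated letters can be merged, which leaves finitely
  many compact sets of weights. The Lagrange multiplier of the constraint \<open>\<Sum> v\<^sub>l = 0\<close> is a
  translation that puts the polygon of a maximizer on the boundary of \<open>q C\<close>, which gives a closed
  characteristic of action \<open>1 / (2 q)\<close> (Haim-Kislev). Hence every word bounds the capacity from above.
  For \<open>K \<times> K\<close> with \<open>\<Sum> \<beta>\<^sub>F n\<^sub>F = 0\<close> the word that visits \<open>(\<beta>\<^sub>F n\<^sub>F, 0)\<close> and \<open>(0, \<beta>\<^sub>F n\<^sub>F)\<close> for one facet after
  the other has form \<open>\<Sum> \<beta>\<^sub>F\<^sup>2\<close>, and the Cauchy-Schwarz inequality concludes.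
\<close>

section \<open>Symplectic linear algebra and a theorem of the alternative\<close>

lemma linear_complex_str: "linear complex_str"
  by (rule linearI) (simp_all add: complex_str_def)

lemma bounded_linear_complex_str: "bounded_linear complex_str"
  by (rule linear_conv_bounded_linear[THEN iffD1, OF linear_complex_str])

lemma sympl_form_eq_inner: "sympl_form x y = - (x \<bullet> complex_str y)"
  by (simp add: sympl_form_def complex_str_def inner_prod_def)

lemma bounded_bilinear_sympl_form: "bounded_bilinear sympl_form"
proof -
  have "bounded_linear (\<lambda>y. - complex_str y)"
    by (rule bounded_linear_minus[OF bounded_linear_complex_str])
  from bounded_bilinear.comp[OF bounded_bilinear_inner bounded_linear_ident this]
  show ?thesis by (simp add: sympl_form_eq_inner[abs_def])
qed

interpretation sympl: bounded_bilinear sympl_form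
  by (rule bounded_bilinear_sympl_form)

lemma sympl_form_self [simp]: "sympl_form x x = 0"
  by (simp add: sympl_form_def inner_commute)

lemma sympl_form_swap: "sympl_form x y = - sympl_form y x"
  by (simp add: sympl_form_def inner_commute)

lemma inner_complex_str: "x \<bullet> complex_str y = sympl_form y x"
  by (simp add: sympl_form_def complex_str_def inner_prod_def inner_commute)

lemma complex_str_eq_0_iff [simp]: "complex_str x = 0 \<longleftrightarrow> x = 0"
  by (auto simp: complex_str_def prod_eq_iff)

text \<open>The cone generated by the finitely many vectors \<open>(v j, r j)\<close> is closed. If
  it contains \<open>(0, 1)\<close>, the coefficients of that vector serve as \<open>l\<close>.
  Otherwise a hyperplane separates \<open>(0, 1)\<close> from the cone, and the first component of
  its normal, rescaled, serves as \<open>b\<close>.\<close>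

lemma farkas:
  fixes v :: "'i \<Rightarrow> 'a::euclidean_space" and r :: "'i \<Rightarrow> real"
  assumes "finite J"
  shows "(\<exists>b. \<forall>j\<in>J. r j \<le> v j \<bullet> b) \<or>
    (\<exists>l. (\<forall>j\<in>J. 0 \<le> l j) \<and> (\<Sum>j\<in>J. l j *\<^sub>R v j) = 0 \<and> 0 < (\<Sum>j\<in>J. l j * r j))"
proof -
  define G where "G = convex_cone hull ((\<lambda>j. (v j, r j)) ` J)"
  define S where "S = {\<Sum>j\<in>J. l j *\<^sub>R (v j, r j) | l. \<forall>j\<in>J. 0 \<le> l j}"
  have GS: "G \<subseteq> S"
    unfolding G_def
  proof (rule hull_minimal)
    show "(\<lambda>j. (v j, r j)) ` J \<subseteq> S"
    proof
      fix y assume "y \<in> (\<lambda>j. (v j, r j)) ` J"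
      then obtain k where k: "k \<in> J" "y = (v k, r k)" by auto
      have "y = (\<Sum>j\<in>J. (if j = k then 1 else 0) *\<^sub>R (v j, r j))"
      proof -
        have "(\<Sum>j\<in>J. (if j = k then 1 else 0) *\<^sub>R (v j, r j)) = (\<Sum>j\<in>J. if j = k then (v k, r k) else 0)"
          by (rule sum.cong) (auto simp: zero_prod_def)
        then show ?thesis using k assms by simp
      qed
      then show "y \<in> S"
        unfolding S_def by (intro CollectI exI[of _ "\<lambda>j. if j = k then 1 else 0"]) auto
    qed
    show "convex_cone S"
      unfolding convex_cone_iff
    proof (intro conjI allI impI ballI)
      show "0 \<in> S" unfolding S_def by (intro CollectI exI[of _ "\<lambda>_. 0"]) (simp add: zero_prod_def[symmetric])
      fix x and c :: real
      assume "x \<in> S" "0 \<le> c"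
      then obtain l where "\<forall>j\<in>J. 0 \<le> l j" "x = (\<Sum>j\<in>J. l j *\<^sub>R (v j, r j))"
        unfolding S_def by auto
      then show "c *\<^sub>R x \<in> S"
        unfolding S_def using \<open>0 \<le> c\<close>
        by (intro CollectI exI[of _ "\<lambda>j. c * l j"]) (simp add: scaleR_sum_right mult.assoc)
    next
      fix x y assume "x \<in> S" "y \<in> S"
      then obtain l l' where "\<forall>j\<in>J. 0 \<le> l j" "x = (\<Sum>j\<in>J. l j *\<^sub>R (v j, r j))"
        "\<forall>j\<in>J. 0 \<le> l' j" "y = (\<Sum>j\<in>J. l' j *\<^sub>R (v j, r j))"
        unfolding S_def by auto
      then show "x + y \<in> S"
        unfolding S_def
        by (intro CollectI exI[of _ "\<lambda>j. l j + l' j"])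
          (auto simp: sum.distrib[symmetric] algebra_simps intro!: sum.cong)
    qed
  qed
  show ?thesis
  proof (cases "(0, 1) \<in> G")
    case True
    then obtain l where l: "\<forall>j\<in>J. 0 \<le> l j" "(0, 1) = (\<Sum>j\<in>J. l j *\<^sub>R (v j, r j))"
      using GS unfolding S_def by auto
    have "fst (\<Sum>j\<in>J. l j *\<^sub>R (v j, r j)) = 0" "snd (\<Sum>j\<in>J. l j *\<^sub>R (v j, r j)) = 1"
      by (simp_all only: l(2)[symmetric] fst_conv snd_conv)
    then show ?thesis
      using l(1) by (intro disjI2 exI[of _ l]) (simp add: fst_sum snd_sum)
  next
    case False
    have "closed G" "convex G" "conic G" "0 \<in> G"
      unfolding G_def using assms
      by (auto simp: closed_convex_cone_hull convex_convex_cone_hull conic_convex_cone_hull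
          convex_cone_hull_contains_0)
    then obtain a \<theta> where a: "a \<bullet> (0, 1) < \<theta>" "\<And>x. x \<in> G \<Longrightarrow> \<theta> < a \<bullet> x"
      using separating_hyperplane_closed_point[of G "(0, 1)"] False by blast
    have "\<theta> < 0" using a(2)[OF \<open>0 \<in> G\<close>] by simp
    \<comment> \<open>A negative value could be rescaled inside the cone to equal
      \<open>\<theta>\<close>, against the strict separation.\<close>
    have pos: "0 \<le> a \<bullet> x" if "x \<in> G" for x
    proof (rule ccontr)
      assume neg: "\<not> 0 \<le> a \<bullet> x"
      then have "0 \<le> \<theta> / (a \<bullet> x)" using \<open>\<theta> < 0\<close> by (simp add: divide_nonpos_neg)
      then have "(\<theta> / (a \<bullet> x)) *\<^sub>R x \<in> G"
        using \<open>conic G\<close> that unfolding conic_def by blast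
      from a(2)[OF this] neg show False by simp
    qed
    obtain b \<beta> where ab: "a = (b, \<beta>)" by (cases a)
    with a(1) \<open>\<theta> < 0\<close> have "\<beta> < 0" by simp
    \<comment> \<open>Separation gives \<open>\<beta> < \<theta> < 0\<close>, so dividing by
      \<open>- \<beta>\<close> preserves the inequality.\<close>
    have "r j \<le> v j \<bullet> ((- 1 / \<beta>) *\<^sub>R b)" if "j \<in> J" for j
    proof -
      have "(v j, r j) \<in> G" unfolding G_def by (rule hull_inc) (use that in auto)
      from pos[OF this] have "0 \<le> b \<bullet> v j + \<beta> * r j" by (simp add: ab)
      then show ?thesis using \<open>\<beta> < 0\<close> by (simp add: field_simps inner_commute)
    qed
    then show ?thesis by blast
  qed
qed

section \<open>Words and their symplectic form\<close>

text \<open>For a closed word this is twice the action of the polygon with these successive edges: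
  along an edge, position and velocity pair as the starting vertex and the edge do, which is the
  shape of \<open>word_form_upt\<close>.\<close>

primrec word_form :: "('a::euclidean_space \<times> 'a) list \<Rightarrow> real" where
  "word_form [] = 0"
| "word_form (v # vs) = sympl_form v (sum_list vs) + word_form vs"

lemma word_form_append:
  "word_form (us @ vs) = word_form us + word_form vs + sympl_form (sum_list us) (sum_list vs)"
  by (induction us) (simp_all add: sympl.add_left sympl.add_right sympl.zero_left)

lemma word_form_upt:
  "word_form (map f [0..<k]) = (\<Sum>l<k. sympl_form (\<Sum>j<l. f j) (f l))"
  by (induction k)
    (simp_all add: word_form_append interv_sum_list_conv_sum_set_nat atLeast0LessThan sympl.zero_right)

text \<open>
  A letter \<open>(i, t)\<close> of a word stands for motion during time \<open>t\<close> with velocity \<open>J (n i)\<close>; the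
  rotation \<open>J\<close> is dropped in \<open>velocities\<close> as it preserves the symplectic form. The cost is twice the
  action of a loop that runs on the facets \<open>n i \<bullet> z = d i\<close>.
\<close>

type_synonym 'i word = "('i \<times> real) list"

definition velocities :: "('i \<Rightarrow> 'a::real_vector) \<Rightarrow> 'i word \<Rightarrow> 'a list" where
  "velocities n L = map (\<lambda>(i, t). t *\<^sub>R n i) L"

definition cost :: "('i \<Rightarrow> real) \<Rightarrow> 'i word \<Rightarrow> real" where
  "cost d L = (\<Sum>(i, t)\<leftarrow>L. t * d i)"

lemma velocities_simps [simp]:
  "velocities n [] = []"
  "velocities n (x # L) = snd x *\<^sub>R n (fst x) # velocities n L"
  "velocities n (L @ L') = velocities n L @ velocities n L'"
  by (simp_all add: velocities_def split_beta)

lemma cost_simps [simp]: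
  "cost d [] = 0"
  "cost d (x # L) = snd x * d (fst x) + cost d L"
  "cost d (L @ L') = cost d L + cost d L'"
  by (simp_all add: cost_def split_beta)

definition nonneg_word :: "'i set \<Rightarrow> 'i word \<Rightarrow> bool" where
  "nonneg_word I L \<longleftrightarrow> (\<forall>x\<in>set L. fst x \<in> I \<and> 0 \<le> snd x)"

text \<open>
  Shifting weight between two occurrences of a letter changes the form affinely, so it does not
  decrease when all the weight is moved to a suitable one of the two.
\<close>

lemma merge_word:
  fixes n :: "'i \<Rightarrow> 'a::euclidean_space \<times> 'a"
  assumes "nonneg_word I L"
  shows "\<exists>L'. nonneg_word I L' \<and> distinct (map fst L') \<and> cost d L' = cost d L \<and>
    sum_list (velocities n L') = sum_list (velocities n L) \<and>
    word_form (velocities n L) \<le> word_form (velocities n L')"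
  using assms
proof (induction "length L" arbitrary: L rule: less_induct)
  case less
  show ?case
  proof (cases "distinct (map fst L)")
    case True
    then show ?thesis using less.prems by blast
  next
    case False
    then obtain xs ys zs i where "map fst L = xs @ [i] @ ys @ [i] @ zs"
      using not_distinct_decomp by blast
    then obtain as bs cs s t where L: "L = as @ [(i, s)] @ bs @ [(i, t)] @ cs"
      by (auto simp: map_eq_append_conv map_eq_Cons_conv append_eq_map_conv Cons_eq_map_conv)
    define B where "B = sum_list (velocities n bs)"
    define L1 where "L1 = as @ [(i, s + t)] @ bs @ cs"
    define L2 where "L2 = as @ bs @ [(i, s + t)] @ cs"
    have st: "0 \<le> s" "0 \<le> t" using less.prems by (auto simp: L nonneg_word_def)
    \<comment> \<open>The moved weight changes its order only relative to \<open>bs\<close>, so its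
      pairing with \<open>B\<close> changes sign; the two occurrences of the letter are parallel and
      pair to zero.\<close>
    have w1: "word_form (velocities n L) - word_form (velocities n L1) = - 2 * t * sympl_form (n i) B"
      unfolding L L1_def
      by (simp add: word_form_append sympl.add_left sympl.add_right sympl.scaleR_left
          sympl.scaleR_right algebra_simps B_def[symmetric] sympl_form_swap[of B] sympl.zero_right sympl.zero_left)
    have w2: "word_form (velocities n L) - word_form (velocities n L2) = 2 * s * sympl_form (n i) B"
      unfolding L L2_def
      by (simp add: word_form_append sympl.add_left sympl.add_right sympl.scaleR_left
          sympl.scaleR_right algebra_simps B_def[symmetric] sympl_form_swap[of B] sympl.zero_right sympl.zero_left)
    define M where "M = (if 0 \<le> sympl_form (n i) B then L1 else L2)"
    have M: "word_form (velocities n L) \<le> word_form (velocities n M)"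
    proof (cases "0 \<le> sympl_form (n i) B")
      case True
      then have "0 \<le> t * sympl_form (n i) B" using st by simp
      then show ?thesis using w1 True by (simp add: M_def)
    next
      case False
      then have "s * sympl_form (n i) B \<le> 0" using st by (simp add: mult_nonneg_nonpos)
      then show ?thesis using w2 False by (simp add: M_def)
    qed
    have "length M < length L" "nonneg_word I M" "cost d M = cost d L"
      "sum_list (velocities n M) = sum_list (velocities n L)"
      using less.prems
      by (auto simp: M_def L L1_def L2_def nonneg_word_def algebra_simps)
    with less.hyps[of M] M show ?thesis by fastforce
  qed
qed

section \<open>Existence of optimal words\<close>

lemma word_form_zeros: "(\<And>v. v \<in> set vs \<Longrightarrow> v = 0) \<Longrightarrow> word_form vs = 0"
proof (induction vs)
  case (Cons a vs)
  then have "a = 0" "word_form vs = 0" by auto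
  then show ?case by (simp add: sympl.zero_left)
qed simp

lemma sum_list_scaleR:
  fixes vs :: "'a::real_vector list"
  shows "sum_list (map ((*\<^sub>R) c) vs) = c *\<^sub>R sum_list vs"
  by (induction vs) (simp_all add: algebra_simps)

lemma word_form_scaleR: "word_form (map ((*\<^sub>R) c) vs) = c\<^sup>2 * word_form vs"
  by (induction vs)
    (simp_all add: sum_list_scaleR sympl.scaleR_left sympl.scaleR_right algebra_simps power2_eq_square)

lemma cost_nonneg:
  assumes "nonneg_word I L" "\<And>i. i \<in> I \<Longrightarrow> 0 < d i"
  shows "0 \<le> cost d L"
  unfolding cost_def
proof (rule sum_list_nonneg)
  fix x assume "x \<in> set (map (\<lambda>(i, t). t * d i) L)"
  then obtain i t where "(i, t) \<in> set L" "x = t * d i" by auto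
  moreover from this have "i \<in> I" "0 \<le> t" using assms(1) by (auto simp: nonneg_word_def)
  ultimately show "0 \<le> x" using assms(2)[of i] by simp
qed

text \<open>Positive costs bound the weights of a word by its cost, so the weights of normalized
  words range over a compact box.\<close>

lemma weight_le_cost:
  assumes "nonneg_word I L" "\<And>i. i \<in> I \<Longrightarrow> 0 < d i" "(i, t) \<in> set L"
  shows "t * d i \<le> cost d L"
proof -
  obtain A B where "L = A @ (i, t) # B" using assms(3) by (meson split_list)
  moreover from this have "nonneg_word I A" "nonneg_word I B"
    using assms(1) by (auto simp: nonneg_word_def)
  ultimately show ?thesis
    using cost_nonneg[of I A d] cost_nonneg[of I B d] assms(2) by simp
qed

lemma continuous_on_word_form:
  "continuous_on UNIV (\<lambda>f. word_form (map (\<lambda>i. f i *\<^sub>R n i) xs))"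
proof (induction xs)
  case (Cons a xs)
  have "continuous_on UNIV (\<lambda>f::_ \<Rightarrow> real. sum_list (map (\<lambda>i. f i *\<^sub>R n i) ys))" for ys
    by (induction ys) (auto intro!: continuous_intros)
  with Cons show ?case
    by (auto intro!: continuous_intros sympl.continuous_on)
qed simp

text \<open>Weights are functions on the whole index type with the product topology. Forcing them to
  vanish off \<open>I\<close> makes every factor compact, and Tychonoff's theorem applies; the two
  remaining conditions are closed, as they depend continuously on finitely many coordinates.\<close>

lemma compact_weights:
  fixes n :: "'i \<Rightarrow> 'a::euclidean_space"
  assumes "\<And>i. i \<in> I \<Longrightarrow> 0 < d i"
  shows "compact {f. (\<forall>i. f i \<in> (if i \<in> I then {0..1 / d i} else {0})) \<and>
    (\<Sum>i\<leftarrow>xs. f i * d i) = (1::real) \<and> sum_list (map (\<lambda>i. f i *\<^sub>R n i) xs) = 0}"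
proof -
  let ?B = "{f. \<forall>i. f i \<in> (if i \<in> I then {0..1 / d i} else {0})}"
  let ?C = "{f. (\<Sum>i\<leftarrow>xs. f i * d i) = (1::real)}"
  let ?D = "{f::'i \<Rightarrow> real. sum_list (map (\<lambda>i. f i *\<^sub>R n i) xs) = 0}"
  have "compactin (product_topology (\<lambda>i. euclidean) UNIV)
      (Pi\<^sub>E UNIV (\<lambda>i. if i \<in> I then {0..1 / d i} else {0}))"
    by (subst compactin_PiE) auto
  then have "compact ?B"
    by (simp add: euclidean_product_topology PiE_UNIV_domain Pi_def)
  moreover have "closed ?C"
  proof (rule closed_Collect_eq)
    show "continuous_on UNIV (\<lambda>f. \<Sum>i\<leftarrow>xs. f i * d i)"
      by (induction xs) (auto intro!: continuous_intros)
  qed auto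
  moreover have "closed ?D"
  proof (rule closed_Collect_eq)
    show "continuous_on UNIV (\<lambda>f. sum_list (map (\<lambda>i. f i *\<^sub>R n i) xs))"
      by (induction xs) (auto intro!: continuous_intros)
  qed auto
  ultimately have "compact (?B \<inter> (?C \<inter> ?D))"
    by (intro compact_Int_closed closed_Int)
  then show ?thesis by (simp add: Collect_conj_eq)
qed

text \<open>After merging, each letter occurs at most once, so its weight is a function
  \<open>f\<close> of the letter. Dividing the weights by the cost normalizes the word and divides
  the form by the square of the cost.\<close>

lemma normalized_distinct_word:
  fixes n :: "'i \<Rightarrow> 'a::euclidean_space \<times> 'a"
  assumes d: "\<And>i. i \<in> I \<Longrightarrow> 0 < d i"
    and L: "nonneg_word I L" "sum_list (velocities n L) = 0" "0 < cost d L"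
  shows "\<exists>xs f. set xs \<subseteq> I \<and> distinct xs \<and> (\<forall>i. f i \<in> (if i \<in> I then {0..1 / d i} else {0})) \<and>
    (\<Sum>i\<leftarrow>xs. f i * d i) = 1 \<and> sum_list (map (\<lambda>i. f i *\<^sub>R n i) xs) = 0 \<and>
    word_form (velocities n L) \<le> word_form (map (\<lambda>i. f i *\<^sub>R n i) xs) * (cost d L)\<^sup>2"
proof -
  define c where "c = cost d L"
  have c: "0 < c" using L(3) by (simp add: c_def)
  obtain M where M: "nonneg_word I M" "distinct (map fst M)" "cost d M = c"
    "sum_list (velocities n M) = 0" "word_form (velocities n L) \<le> word_form (velocities n M)"
    using merge_word[OF L(1), of d n] L(2) unfolding c_def by auto
  define xs where "xs = map fst M"
  define f where "f i = (case map_of M i of None \<Rightarrow> 0 | Some t \<Rightarrow> t / c)" for i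
  have fM: "f i = t / c" if "(i, t) \<in> set M" for i t
    using map_of_is_SomeI[OF M(2) that] by (simp add: f_def)
  have xsI: "set xs \<subseteq> I" using M(1) by (auto simp: xs_def nonneg_word_def)
  have box: "f i \<in> (if i \<in> I then {0..1 / d i} else {0})" for i
  proof (cases "i \<in> set xs")
    case True
    then obtain t where t: "(i, t) \<in> set M" by (auto simp: xs_def)
    then have "i \<in> I" "0 \<le> t" using M(1) by (auto simp: nonneg_word_def)
    moreover have "t * d i \<le> c" using weight_le_cost[of I M d i t] M(1,3) d t by simp
    ultimately show ?thesis using c d[of i] by (simp add: fM[OF t] field_simps)
  next
    case False
    then have "map_of M i = None" by (simp add: xs_def map_of_eq_None_iff)
    then show ?thesis using d[of i] by (auto simp: f_def)
  qed
  have v: "map (\<lambda>i. f i *\<^sub>R n i) xs = map ((*\<^sub>R) (1 / c)) (velocities n M)"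
    by (auto simp: xs_def velocities_def fM divide_inverse mult.commute)
  have "(\<Sum>i\<leftarrow>xs. f i * d i) = (\<Sum>(i, t)\<leftarrow>M. (t * d i) / c)"
    unfolding xs_def by (auto intro!: arg_cong[of _ _ sum_list] simp: fM)
  also have "\<dots> = cost d M / c"
    by (induction M) (auto simp: add_divide_distrib)
  finally have cst: "(\<Sum>i\<leftarrow>xs. f i * d i) = 1" using M(3) c by simp
  have "word_form (map (\<lambda>i. f i *\<^sub>R n i) xs) * c\<^sup>2 = word_form (velocities n M)"
    unfolding v word_form_scaleR using c by (simp add: field_simps)
  moreover have "sum_list (map (\<lambda>i. f i *\<^sub>R n i) xs) = 0"
    unfolding v sum_list_scaleR using M(4) by simp
  moreover have "distinct xs" using M(2) by (simp add: xs_def)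
  ultimately show ?thesis
    using xsI box cst M(5) unfolding c_def[symmetric]
    by (intro exI[of _ xs] exI[of _ f] conjI allI) simp_all
qed

text \<open>There are finitely many orderings of distinct letters; each attains its maximum on a
  compact set of weights, and the best of these maxima is global. \<open>L0\<close> ensures that
  some ordering has admissible weights. The factor \<open>(cost d L')\<^sup>2\<close> compares words
  of any cost, the form being homogeneous of degree two.\<close>

lemma optimal_word:
  fixes n :: "'i \<Rightarrow> 'a::euclidean_space \<times> 'a"
  assumes fin: "finite I" and d: "\<And>i. i \<in> I \<Longrightarrow> 0 < d i"
    and L0: "nonneg_word I L0" "sum_list (velocities n L0) = 0" "0 < word_form (velocities n L0)"
  shows "\<exists>L. nonneg_word I L \<and> sum_list (velocities n L) = 0 \<and> cost d L = 1 \<and>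
    (\<forall>L'. nonneg_word I L' \<longrightarrow> sum_list (velocities n L') = 0 \<longrightarrow>
      word_form (velocities n L') \<le> word_form (velocities n L) * (cost d L')\<^sup>2)"
proof -
  define S where "S xs = {f. (\<forall>i. f i \<in> (if i \<in> I then {0..1 / d i} else {0})) \<and>
    (\<Sum>i\<leftarrow>xs. f i * d i) = (1::real) \<and> sum_list (map (\<lambda>i. f i *\<^sub>R n i) xs) = 0}" for xs
  define W where "W f xs = word_form (map (\<lambda>i. f i *\<^sub>R n i) xs)" for f xs
  define A where "A = {xs. set xs \<subseteq> I \<and> distinct xs \<and> S xs \<noteq> {}}"
  \<comment> \<open>Words without positive cost cannot be normalized; their weights all vanish, so
    they satisfy the final inequality trivially.\<close>
  have zero: "word_form (velocities n L) = 0" if "nonneg_word I L" "cost d L \<le> 0" for L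
  proof (rule word_form_zeros)
    fix v assume "v \<in> set (velocities n L)"
    then obtain i t where it: "(i, t) \<in> set L" "v = t *\<^sub>R n i" by (auto simp: velocities_def)
    then have "i \<in> I" "0 \<le> t" using that(1) by (auto simp: nonneg_word_def)
    moreover have "t * d i \<le> 0" using weight_le_cost[of I L d i t] that d it(1) by simp
    ultimately have "t = 0" using d[of i] by (simp add: mult_le_0_iff)
    then show "v = 0" using it by simp
  qed
  have reduce: "\<exists>xs f. xs \<in> A \<and> f \<in> S xs \<and> word_form (velocities n L) \<le> W f xs * (cost d L)\<^sup>2"
    if L: "nonneg_word I L" "sum_list (velocities n L) = 0" "0 < cost d L" for L
  proof -
    have "\<exists>xs f. set xs \<subseteq> I \<and> distinct xs \<and> f \<in> S xs \<and>
        word_form (velocities n L) \<le> W f xs * (cost d L)\<^sup>2"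
      using normalized_distinct_word[where d = d, OF d L]
      unfolding S_def W_def by (simp only: mem_Collect_eq conj_assoc)
    then obtain xs f where xf: "set xs \<subseteq> I" "distinct xs" "f \<in> S xs"
      "word_form (velocities n L) \<le> W f xs * (cost d L)\<^sup>2"
      by (elim exE conjE)
    then have "xs \<in> A" by (auto simp: A_def)
    with xf show ?thesis by blast
  qed
  have "\<exists>g\<in>S xs. \<forall>f\<in>S xs. W f xs \<le> W g xs" if "xs \<in> A" for xs
  proof (rule continuous_attains_sup)
    show "compact (S xs)" unfolding S_def by (rule compact_weights[where d = d, OF d])
    show "S xs \<noteq> {}" using that by (simp add: A_def)
    show "continuous_on (S xs) (\<lambda>f. W f xs)"
      unfolding W_def by (rule continuous_on_subset[OF continuous_on_word_form]) simp
  qed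
  then obtain g where g: "\<And>xs. xs \<in> A \<Longrightarrow> g xs \<in> S xs"
    "\<And>xs f. xs \<in> A \<Longrightarrow> f \<in> S xs \<Longrightarrow> W f xs \<le> W (g xs) xs" by metis
  have "0 < cost d L0" using zero[OF L0(1)] L0(3) by force
  from reduce[OF L0(1,2) this] have "A \<noteq> {}" by auto
  have finA: "finite A"
    by (rule finite_subset[OF _ finite_subset_distinct[OF fin]]) (auto simp: A_def)
  then have "Max ((\<lambda>ys. W (g ys) ys) ` A) \<in> (\<lambda>ys. W (g ys) ys) ` A" 
    using \<open>A \<noteq> {}\<close> by (intro Max_in) auto
  then obtain xs where xsA: "xs \<in> A" "Max ((\<lambda>ys. W (g ys) ys) ` A) = W (g xs) xs" by auto
  have "W (g ys) ys \<le> Max ((\<lambda>ys. W (g ys) ys) ` A)" if "ys \<in> A" for ys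
    using finA that by (intro Max_ge) auto
  with xsA have xs: "xs \<in> A" "\<And>ys. ys \<in> A \<Longrightarrow> W (g ys) ys \<le> W (g xs) xs" by auto
  define L where "L = map (\<lambda>i. (i, g xs i)) xs"
  have gS: "g xs \<in> S xs" by (rule g(1)[OF xs(1)])
  have vL: "velocities n L = map (\<lambda>i. g xs i *\<^sub>R n i) xs"
    by (simp add: L_def velocities_def)
  have WL: "word_form (velocities n L) = W (g xs) xs" by (simp add: vL W_def)
  show ?thesis
  proof (intro exI[of _ L] conjI allI impI)
    show "nonneg_word I L"
      unfolding nonneg_word_def
    proof
      fix x assume "x \<in> set L"
      then obtain i where i: "i \<in> set xs" "x = (i, g xs i)" by (auto simp: L_def)
      then have "i \<in> I" using xs(1) by (auto simp: A_def)
      moreover have "g xs i \<in> (if i \<in> I then {0..1 / d i} else {0})"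
        using gS unfolding S_def by blast
      ultimately show "fst x \<in> I \<and> 0 \<le> snd x" using i by simp
    qed
    show "sum_list (velocities n L) = 0" using gS by (simp add: vL S_def)
    show "cost d L = 1" using gS by (simp add: L_def cost_def S_def comp_def)
    show "word_form (velocities n L') \<le> word_form (velocities n L) * (cost d L')\<^sup>2"
      if L': "nonneg_word I L'" "sum_list (velocities n L') = 0" for L'
    proof (cases "0 < cost d L'")
      case True
      then obtain ys f where yf: "ys \<in> A" "f \<in> S ys"
        "word_form (velocities n L') \<le> W f ys * (cost d L')\<^sup>2"
        using reduce[OF L'] by blast
      have "W f ys \<le> W (g xs) xs" using g(2)[OF yf(1,2)] xs(2)[OF yf(1)] by linarith
      then have "W f ys * (cost d L')\<^sup>2 \<le> W (g xs) xs * (cost d L')\<^sup>2"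
        by (rule mult_right_mono) simp
      with yf(3) WL show ?thesis by simp
    next
      case False
      then have "cost d L' = 0" using cost_nonneg[where d = d, OF L'(1) d] by simp
      then show ?thesis using zero[OF L'(1)] by simp
    qed
  qed
qed

section \<open>The Lagrange multiplier of an optimal word\<close>

text \<open>Summation by parts: the pairings over all index pairs give the boundary term, the
  diagonal vanishes, and antisymmetry turns the pairs on one side of the diagonal into those on the
  other.\<close>

lemma sum_sympl_parts:
  fixes x y :: "nat \<Rightarrow> 'a::euclidean_space \<times> 'a"
  assumes "\<And>r. r < k \<Longrightarrow> sympl_form (x r) (y r) = 0"
  shows "(\<Sum>r<k. sympl_form (\<Sum>j<r. y j) (x r)) =
    sympl_form (\<Sum>j<k. y j) (\<Sum>j<k. x j) + (\<Sum>r<k. sympl_form (\<Sum>j<r. x j) (y r))"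
  using assms
proof (induction k)
  case (Suc k)
  have "sympl_form (y k) (\<Sum>j<k. x j) = - sympl_form (\<Sum>j<k. x j) (y k)"
    "sympl_form (y k) (x k) = 0"
    using Suc.prems[of k] by (subst sympl_form_swap; simp)+
  with Suc show ?case by (simp add: sympl.add_left sympl.add_right)
qed (simp add: sympl.zero_left)

lemma word_eq_map_nth: "L = map (\<lambda>r. (fst (L ! r), snd (L ! r))) [0..<length L]"
  by (simp add: map_nth)

lemma velocities_upt: "velocities n (map (\<lambda>r. (i r, a r)) [0..<k]) = map (\<lambda>r. a r *\<^sub>R n (i r)) [0..<k]"
  by (simp add: velocities_def)

lemma cost_upt: "cost d (map (\<lambda>r. (i r, a r)) [0..<k]) = (\<Sum>r<k. a r * d (i r))"
  by (simp add: cost_def comp_def interv_sum_list_conv_sum_set_nat atLeast0LessThan)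

lemma sum_list_velocities_upt:
  "sum_list (velocities n (map (\<lambda>r. (i r, a r)) [0..<k])) = (\<Sum>r<k. a r *\<^sub>R n (i r))"
  by (simp add: velocities_upt interv_sum_list_conv_sum_set_nat atLeast0LessThan)

text \<open>The vector \<open>b\<close> is the multiplier of the closing constraint. If there were
  none, \<open>farkas\<close> would supply a non-negative direction \<open>l\<close> that keeps the
  word closed and along which the form minus \<open>q\<close> times the squared cost has positive
  derivative at \<open>a\<close>. This difference is zero at \<open>a\<close>, so \<open>opt\<close>
  would fail for small steps.\<close>

lemma first_order_condition:
  fixes n :: "'i \<Rightarrow> 'a::euclidean_space \<times> 'a" and i :: "nat \<Rightarrow> 'i" and a :: "nat \<Rightarrow> real" and k :: nat
  defines "X \<equiv> \<lambda>r. \<Sum>j<r. a j *\<^sub>R n (i j)"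
  defines "q \<equiv> \<Sum>r<k. sympl_form (X r) (a r *\<^sub>R n (i r))"
  assumes a: "\<And>r. r < k \<Longrightarrow> 0 \<le> a r" and closed: "X k = 0"
    and cost: "(\<Sum>r<k. a r * d (i r)) = 1"
    and opt: "\<And>a'. (\<And>r. r < k \<Longrightarrow> 0 \<le> a' r) \<Longrightarrow> (\<Sum>r<k. a' r *\<^sub>R n (i r)) = 0 \<Longrightarrow>
      (\<Sum>r<k. sympl_form (\<Sum>j<r. a' j *\<^sub>R n (i j)) (a' r *\<^sub>R n (i r))) \<le> q * (\<Sum>r<k. a' r * d (i r))\<^sup>2"
  shows "\<exists>b. \<forall>r<k. sympl_form (X r) (n (i r)) + b \<bullet> n (i r) \<le> q * d (i r)"
proof -
  let ?r = "\<lambda>r. sympl_form (X r) (n (i r)) - q * d (i r)"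
  consider b where "\<forall>r<k. ?r r \<le> n (i r) \<bullet> b"
    | l where "\<forall>r<k. 0 \<le> l r" "(\<Sum>r<k. l r *\<^sub>R n (i r)) = 0" "0 < (\<Sum>r<k. l r * ?r r)"
    using farkas[of "{..<k}" ?r "\<lambda>r. n (i r)"] by auto
  then show ?thesis
  proof cases
    case (1 b)
    then show ?thesis
      by (intro exI[of _ "- b"]) (auto simp: inner_commute algebra_simps)
  next
    case (2 l)
    define x where "x r = a r *\<^sub>R n (i r)" for r
    define y where "y r = l r *\<^sub>R n (i r)" for r
    define Q where "Q = (\<Sum>r<k. sympl_form (\<Sum>j<r. y j) (y r))"
    define P where "P = (\<Sum>r<k. sympl_form (X r) (y r))"
    define D where "D = (\<Sum>r<k. l r * d (i r))"
    have X: "X r = (\<Sum>j<r. x j)" for r by (simp add: X_def x_def)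
    \<comment> \<open>Both mixed terms of the quadratic expansion equal \<open>P\<close>: the
      boundary term of the summation by parts vanishes because \<open>x\<close> closes up, the
      diagonal because \<open>x r\<close> and \<open>y r\<close> are parallel.\<close>
    have "(\<Sum>r<k. sympl_form (\<Sum>j<r. y j) (x r)) = P"
      using sum_sympl_parts[of k x y] closed
      by (simp add: x_def y_def X_def P_def sympl.scaleR_left sympl.scaleR_right sympl.zero_right)
    then have expand: "(\<Sum>r<k. sympl_form (\<Sum>j<r. x j + s *\<^sub>R y j) (x r + s *\<^sub>R y r)) = q + 2 * s * P + s\<^sup>2 * Q" for s
      by (simp add: sum.distrib sympl.add_left sympl.add_right scaleR_sum_right[symmetric]
          sympl.scaleR_left sympl.scaleR_right sum_distrib_left[symmetric] q_def P_def Q_def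
          X[symmetric] x_def[symmetric] power2_eq_square algebra_simps)
    \<comment> \<open>At \<open>a\<close> there is equality in \<open>opt\<close>, so the constant
      terms cancel and one factor \<open>s\<close> can be divided out.\<close>
    have ineq: "2 * (P - q * D) \<le> s * (q * D\<^sup>2 - Q)" if "0 < s" for s
    proof -
      have "(\<Sum>r<k. sympl_form (\<Sum>j<r. (a j + s * l j) *\<^sub>R n (i j)) ((a r + s * l r) *\<^sub>R n (i r)))
          \<le> q * (\<Sum>r<k. (a r + s * l r) * d (i r))\<^sup>2"
      proof (rule opt)
        show "0 \<le> a r + s * l r" if "r < k" for r using a[OF that] 2(1) that \<open>0 < s\<close> by simp
        show "(\<Sum>r<k. (a r + s * l r) *\<^sub>R n (i r)) = 0"
          using closed 2(2)
          by (simp add: X_def scaleR_left_distrib sum.distrib scaleR_sum_right[symmetric]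
              flip: scaleR_scaleR)
      qed
      also have "(\<Sum>r<k. (a r + s * l r) * d (i r)) = 1 + s * D"
        using cost by (simp add: D_def sum_distrib_left sum.distrib algebra_simps)
      finally have "q + 2 * s * P + s\<^sup>2 * Q \<le> q * (1 + s * D)\<^sup>2"
        using expand[of s] by (simp add: x_def y_def scaleR_left_distrib)
      then have "s * (2 * (P - q * D)) \<le> s * (s * (q * D\<^sup>2 - Q))"
        by (simp add: power2_eq_square algebra_simps)
      then show ?thesis using that by simp
    qed
    \<comment> \<open>Letting \<open>s\<close> tend to \<open>0\<close> from the right removes the
      quadratic remainder and leaves a contradiction to the positivity from
      \<open>farkas\<close>.\<close>
    have "((\<lambda>s. s * (q * D\<^sup>2 - Q)) \<longlongrightarrow> 0 * (q * D\<^sup>2 - Q)) (at_right 0)"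
      by (intro tendsto_intros)
    moreover have "eventually (\<lambda>s. 2 * (P - q * D) \<le> s * (q * D\<^sup>2 - Q)) (at_right 0)"
      using ineq by (auto simp: eventually_at_right_field intro: exI[of _ 1])
    ultimately have "2 * (P - q * D) \<le> 0 * (q * D\<^sup>2 - Q)"
      by (rule tendsto_lowerbound) simp
    moreover have "(\<Sum>r<k. l r * ?r r) = P - q * D"
      by (simp add: P_def D_def y_def sympl.scaleR_right right_diff_distrib sum_subtractf
          sum_distrib_left mult.left_commute)
    ultimately show ?thesis using 2(3) by simp
  qed
qed

lemma sum_list_velocities_take: "r \<le> length L \<Longrightarrow>
  sum_list (velocities n (take r L)) = (\<Sum>j<r. snd (L ! j) *\<^sub>R n (fst (L ! j)))"
proof (induction r)
  case (Suc r)
  then have "take (Suc r) L = take r L @ [L ! r]" by (simp add: take_Suc_conv_app_nth)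
  with Suc show ?case by simp
qed simp

text \<open>Words with the letters of \<open>L\<close> in the same order and any non-negative
  weights compete with \<open>L\<close>, so the first-order condition applies to the weights. It is
  phrased by splittings of the list, the way a padded word is taken apart later.\<close>

lemma optimal_word_multiplier:
  fixes n :: "'i \<Rightarrow> 'a::euclidean_space \<times> 'a"
  assumes L: "nonneg_word I L" "sum_list (velocities n L) = 0" "cost d L = 1"
    and opt: "\<And>L'. nonneg_word I L' \<Longrightarrow> sum_list (velocities n L') = 0 \<Longrightarrow>
      word_form (velocities n L') \<le> word_form (velocities n L) * (cost d L')\<^sup>2"
  shows "\<exists>b. \<forall>A i t B. L = A @ (i, t) # B \<longrightarrow>
    sympl_form (sum_list (velocities n A)) (n i) + b \<bullet> n i \<le> word_form (velocities n L) * d i"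
proof -
  define i where "i r = fst (L ! r)" for r
  define a where "a r = snd (L ! r)" for r
  define k where "k = length L"
  have Lk: "L = map (\<lambda>r. (i r, a r)) [0..<k]"
    unfolding i_def a_def k_def by (rule word_eq_map_nth)
  have ia: "i r \<in> I" "0 \<le> a r" if "r < k" for r
    using L(1) that by (auto simp: nonneg_word_def i_def a_def k_def)
  have wf: "word_form (velocities n (map (\<lambda>r. (i r, a' r)) [0..<k])) =
      (\<Sum>r<k. sympl_form (\<Sum>j<r. a' j *\<^sub>R n (i j)) (a' r *\<^sub>R n (i r)))" for a'
    by (simp add: velocities_upt word_form_upt)
  note q = wf[of a, folded Lk]
  have "\<exists>b. \<forall>r<k. sympl_form (\<Sum>j<r. a j *\<^sub>R n (i j)) (n (i r)) + b \<bullet> n (i r)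
      \<le> (\<Sum>r<k. sympl_form (\<Sum>j<r. a j *\<^sub>R n (i j)) (a r *\<^sub>R n (i r))) * d (i r)"
  proof (rule first_order_condition)
    show "(\<Sum>j<k. a j *\<^sub>R n (i j)) = 0" using L(2) by (subst (asm) Lk) (simp add: sum_list_velocities_upt)
    show "(\<Sum>r<k. a r * d (i r)) = 1" using L(3) by (subst (asm) Lk) (simp add: cost_upt)
    fix a' :: "nat \<Rightarrow> real"
    assume a': "\<And>r. r < k \<Longrightarrow> 0 \<le> a' r" "(\<Sum>r<k. a' r *\<^sub>R n (i r)) = 0"
    have "nonneg_word I (map (\<lambda>r. (i r, a' r)) [0..<k])"
      using a' ia by (auto simp: nonneg_word_def)
    from opt[OF this] a'(2)
    show "(\<Sum>r<k. sympl_form (\<Sum>j<r. a' j *\<^sub>R n (i j)) (a' r *\<^sub>R n (i r))) \<le>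
        (\<Sum>r<k. sympl_form (\<Sum>j<r. a j *\<^sub>R n (i j)) (a r *\<^sub>R n (i r))) * (\<Sum>r<k. a' r * d (i r))\<^sup>2"
      by (simp add: sum_list_velocities_upt cost_upt wf q)
  qed (use ia in auto)
  then obtain b where b: "\<And>r. r < k \<Longrightarrow> sympl_form (\<Sum>j<r. a j *\<^sub>R n (i j)) (n (i r)) + b \<bullet> n (i r)
      \<le> word_form (velocities n L) * d (i r)" using q by auto
  show ?thesis
  proof (intro exI[of _ b] allI impI)
    fix A j t B assume AB: "L = A @ (j, t) # B"
    define r where "r = length A"
    have "r < k" "i r = j" "take r L = A" by (simp_all add: AB r_def k_def i_def)
    with b[of r] sum_list_velocities_take[of r L n]
    show "sympl_form (sum_list (velocities n A)) (n j) + b \<bullet> n j \<le> word_form (velocities n L) * d j"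
      by (simp add: i_def a_def k_def)
  qed
qed

section \<open>Inequalities at every junction, and complementary slackness\<close>

definition pad :: "'i word \<Rightarrow> 'i word \<Rightarrow> 'i word" where
  "pad Z L = concat (map (\<lambda>x. x # Z) L)"

lemma pad_simps [simp]:
  "pad Z [] = []"
  "pad Z (x # L) = x # Z @ pad Z L"
  "pad Z (A @ B) = pad Z A @ pad Z B"
  by (simp_all add: pad_def)

lemma velocities_zero_weights:
  assumes "\<And>x. x \<in> set Z \<Longrightarrow> snd x = 0"
  shows "sum_list (velocities n Z) = 0" "cost d Z = 0" "word_form (velocities n Z) = 0"
  using assms by (induction Z) (auto simp: sympl.zero_left)

lemma pad_zero_weights:
  assumes "\<And>x. x \<in> set Z \<Longrightarrow> snd x = 0"
  shows "sum_list (velocities n (pad Z L)) = sum_list (velocities n L)"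
    "cost d (pad Z L) = cost d L"
    "word_form (velocities n (pad Z L)) = word_form (velocities n L)"
proof -
  note z = velocities_zero_weights[OF assms]
  show s: "sum_list (velocities n (pad Z L)) = sum_list (velocities n L)" for L
    by (induction L) (simp_all add: z)
  show "cost d (pad Z L) = cost d L"
    by (induction L) (simp_all add: z)
  show "word_form (velocities n (pad Z L)) = word_form (velocities n L)"
    by (induction L) (simp_all add: z s word_form_append sympl.zero_left)
qed

text \<open>
  Padding an optimal word with all letters of weight \<open>0\<close> at every junction keeps it optimal, so the
  multiplier of the padded word bounds every letter at every junction.
\<close>

lemma optimal_word_junctions:
  fixes n :: "'i \<Rightarrow> 'a::euclidean_space \<times> 'a"
  assumes fin: "finite I" and L: "nonneg_word I L" "sum_list (velocities n L) = 0" "cost d L = 1"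
    and opt: "\<And>L'. nonneg_word I L' \<Longrightarrow> sum_list (velocities n L') = 0 \<Longrightarrow>
      word_form (velocities n L') \<le> word_form (velocities n L) * (cost d L')\<^sup>2"
  shows "\<exists>b. \<forall>r\<le>length L. \<forall>i\<in>I. sympl_form (sum_list (velocities n (take r L))) (n i) + b \<bullet> n i
    \<le> word_form (velocities n L) * d i"
proof -
  obtain js where js: "set js = I" using finite_list[OF fin] by blast
  define Z where "Z = map (\<lambda>i. (i, 0::real)) js"
  have Z0: "\<And>x. x \<in> set Z \<Longrightarrow> snd x = 0" by (auto simp: Z_def)
  note z = velocities_zero_weights[OF Z0] pad_zero_weights[OF Z0]
  \<comment> \<open>The leading copy of \<open>Z\<close> takes care of the junction before the first
    letter.\<close>
  define R where "R = Z @ pad Z L"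
  have R: "nonneg_word I R" "sum_list (velocities n R) = 0" "cost d R = 1"
    "word_form (velocities n R) = word_form (velocities n L)"
  proof -
    show "nonneg_word I R" using L(1) by (auto simp: R_def Z_def js nonneg_word_def pad_def)
  qed (use L(2,3) in \<open>simp_all add: R_def z word_form_append sympl.zero_left\<close>)
  obtain b where b: "\<And>A i t B. R = A @ (i, t) # B \<Longrightarrow>
      sympl_form (sum_list (velocities n A)) (n i) + b \<bullet> n i \<le> word_form (velocities n L) * d i"
    using optimal_word_multiplier[OF R(1-3)] opt unfolding R(4) by metis
  show ?thesis
  proof (intro exI[of _ b] allI impI ballI)
    fix r i assume "r \<le> length L" "i \<in> I"
    define A where "A = take r L"
    have R': "R = (Z @ pad Z A) @ pad Z (drop r L)"
      unfolding R_def A_def by (subst append_take_drop_id[of r L, symmetric]) (simp only: pad_simps append_assoc)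
    \<comment> \<open>The junction after \<open>A\<close> ends with a copy of \<open>Z\<close>: the
      one following the last letter of \<open>A\<close>, or the leading one if \<open>A\<close> is
      empty.\<close>
    have "\<exists>C. Z @ pad Z A = C @ Z \<and> sum_list (velocities n C) = sum_list (velocities n A)"
    proof (cases A rule: rev_cases)
      case (snoc A' x)
      then show ?thesis
        by (intro exI[of _ "Z @ pad Z A' @ [x]"]) (simp add: z)
    qed simp
    then obtain C where C: "Z @ pad Z A = C @ Z" "sum_list (velocities n C) = sum_list (velocities n A)"
      by blast
    \<comment> \<open>Inside this copy the letter \<open>i\<close> is preceded only by further
      letters of weight zero, so the partial sum in front of it is that of \<open>A\<close>.\<close>
    have "(i, 0) \<in> set Z" using \<open>i \<in> I\<close> js by (auto simp: Z_def)
    then obtain Z1 Z2 where Z: "Z = Z1 @ (i, 0) # Z2" by (meson split_list)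
    have split: "Z @ W = Z1 @ (i, 0) # Z2 @ W" for W by (simp add: Z)
    have "sum_list (velocities n Z1) = 0"
      by (rule velocities_zero_weights) (use Z0 Z in auto)
    then have "sum_list (velocities n (C @ Z1)) = sum_list (velocities n A)"
      by (simp add: C(2))
    moreover have "R = (C @ Z1) @ (i, 0) # (Z2 @ pad Z (drop r L))"
      unfolding R' C(1) append_assoc append_Cons[symmetric]
      by (simp only: split append_assoc append_Cons)
    ultimately show "sympl_form (sum_list (velocities n (take r L))) (n i) + b \<bullet> n i
        \<le> word_form (velocities n L) * d i"
      using b unfolding A_def by metis
  qed
qed

text \<open>Geometrically, the points \<open>b\<close> plus the rotated partial sums lie in the
  \<open>q\<close>-fold multiple of the body cut out by the inequalities
  \<open>n j \<bullet> z \<le> d j\<close>, and each edge of positive weight starts on the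
  hyperplane with normal \<open>n (i r)\<close>.\<close>

lemma optimal_loop:
  fixes n :: "'i \<Rightarrow> 'a::euclidean_space \<times> 'a"
  assumes fin: "finite I" and d: "\<And>i. i \<in> I \<Longrightarrow> 0 < d i"
    and L0: "nonneg_word I L0" "sum_list (velocities n L0) = 0" "0 < word_form (velocities n L0)"
      "cost d L0 = 1"
  shows "\<exists>(k::nat) i t q b. word_form (velocities n L0) \<le> q \<and> (\<forall>r<k. i r \<in> I \<and> 0 \<le> t r) \<and>
    (\<Sum>r<k. t r * d (i r)) = 1 \<and> (\<Sum>r<k. t r *\<^sub>R n (i r)) = 0 \<and>
    (\<forall>r\<le>k. \<forall>j\<in>I. sympl_form (\<Sum>l<r. t l *\<^sub>R n (i l)) (n j) + b \<bullet> n j \<le> q * d j) \<and>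
    (\<forall>r<k. 0 < t r \<longrightarrow>
      sympl_form (\<Sum>l<r. t l *\<^sub>R n (i l)) (n (i r)) + b \<bullet> n (i r) = q * d (i r))"
proof -
  have "\<exists>L. nonneg_word I L \<and> sum_list (velocities n L) = 0 \<and> cost d L = 1 \<and>
      (\<forall>L'. nonneg_word I L' \<longrightarrow> sum_list (velocities n L') = 0 \<longrightarrow>
        word_form (velocities n L') \<le> word_form (velocities n L) * (cost d L')\<^sup>2)"
    by (rule optimal_word[OF fin _ L0(1-3)]) (rule d)
  then obtain L where "nonneg_word I L \<and> sum_list (velocities n L) = 0 \<and> cost d L = 1 \<and>
      (\<forall>L'. nonneg_word I L' \<longrightarrow> sum_list (velocities n L') = 0 \<longrightarrow>
        word_form (velocities n L') \<le> word_form (velocities n L) * (cost d L')\<^sup>2)"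
    by (elim exE)
  then have L: "nonneg_word I L" "sum_list (velocities n L) = 0" "cost d L = 1"
    and opt: "\<And>L'. nonneg_word I L' \<Longrightarrow> sum_list (velocities n L') = 0 \<Longrightarrow>
      word_form (velocities n L') \<le> word_form (velocities n L) * (cost d L')\<^sup>2"
    by simp_all
  define q where "q = word_form (velocities n L)"
  have "\<exists>b. \<forall>r\<le>length L. \<forall>j\<in>I.
      sympl_form (sum_list (velocities n (take r L))) (n j) + b \<bullet> n j \<le> q * d j"
    unfolding q_def by (rule optimal_word_junctions[OF fin L]) (rule opt)
  then obtain b where b: "\<forall>r\<le>length L. \<forall>j\<in>I.
      sympl_form (sum_list (velocities n (take r L))) (n j) + b \<bullet> n j \<le> q * d j"
    by (elim exE)
  define i where "i r = fst (L ! r)" for r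
  define a where "a r = snd (L ! r)" for r
  define k where "k = length L"
  define X where "X r = (\<Sum>l<r. a l *\<^sub>R n (i l))" for r
  have Lk: "L = map (\<lambda>r. (i r, a r)) [0..<k]"
    unfolding i_def a_def k_def by (rule word_eq_map_nth)
  have ia: "i r \<in> I" "0 \<le> a r" if "r < k" for r
    using L(1) that by (auto simp: nonneg_word_def i_def a_def k_def)
  have X: "sympl_form (X r) (n j) + b \<bullet> n j \<le> q * d j" if "r \<le> k" "j \<in> I" for r j
  proof -
    have r: "r \<le> length L" using that(1) by (simp only: k_def)
    have "sum_list (velocities n (take r L)) = X r"
      unfolding sum_list_velocities_take[OF r] X_def i_def a_def ..
    then show ?thesis using b[rule_format, OF r that(2)] by (simp only:)
  qed
  have c: "(\<Sum>r<k. a r * d (i r)) = 1" using L(3) by (subst (asm) Lk) (simp add: cost_upt)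
  have s: "(\<Sum>r<k. a r *\<^sub>R n (i r)) = 0"
    using L(2) by (subst (asm) Lk) (simp add: sum_list_velocities_upt)
  have q: "q = (\<Sum>r<k. sympl_form (X r) (a r *\<^sub>R n (i r)))"
    unfolding q_def X_def by (subst Lk) (simp add: velocities_upt word_form_upt)
  \<comment> \<open>Complementary slackness: the weighted slacks are non-negative and add up to
    \<open>q - q - b \<bullet> 0\<close>, hence each of them vanishes.\<close>
  define g where "g r = a r * (q * d (i r) - (sympl_form (X r) (n (i r)) + b \<bullet> n (i r)))" for r
  have "(\<Sum>r<k. g r) = q * (\<Sum>r<k. a r * d (i r)) - (\<Sum>r<k. sympl_form (X r) (a r *\<^sub>R n (i r)))
      - b \<bullet> (\<Sum>r<k. a r *\<^sub>R n (i r))"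
    by (simp add: g_def sum_distrib_left inner_sum_right sum_subtractf sum.distrib
        right_diff_distrib distrib_left sympl.scaleR_right mult.left_commute)
  then have "(\<Sum>r<k. g r) = 0" by (simp add: c s q[symmetric])
  moreover have "(\<Sum>r<k. g r) = 0 \<longleftrightarrow> (\<forall>r\<in>{..<k}. g r = 0)"
    by (rule sum_nonneg_eq_0_iff) (use X ia in \<open>auto simp: g_def\<close>)
  ultimately have "\<forall>r\<in>{..<k}. g r = 0" by simp
  then have g0: "g r = 0" if "r < k" for r using that by simp
  have eq: "sympl_form (X r) (n (i r)) + b \<bullet> n (i r) = q * d (i r)" if "r < k" "0 < a r" for r
    using g0[OF that(1)] that(2) by (simp add: g_def)
  show ?thesis
  proof (intro exI[of _ k] exI[of _ i] exI[of _ a] exI[of _ q] exI[of _ b] conjI allI impI ballI)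
    show "word_form (velocities n L0) \<le> q" using opt[OF L0(1,2)] L0(4) by (simp add: q_def)
    show "sympl_form (\<Sum>l<r. a l *\<^sub>R n (i l)) (n j) + b \<bullet> n j \<le> q * d j" if "r \<le> k" "j \<in> I" for r j
      using X[OF that] by (simp only: X_def)
    show "sympl_form (\<Sum>l<r. a l *\<^sub>R n (i l)) (n (i r)) + b \<bullet> n (i r) = q * d (i r)"
      if "r < k" "0 < a r" for r
      using eq[OF that] by (simp only: X_def)
  qed (use ia c s in auto)
qed

section \<open>Polygonal closed characteristics\<close>

text \<open>The time spent so far on an edge of duration \<open>t\<close>, at time \<open>s\<close>
  after its start. A path written as a sum of ramps is Lipschitz on the whole line without a case
  distinction between edges.\<close>

definition ramp :: "real \<Rightarrow> real \<Rightarrow> real" where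
  "ramp t s = max 0 (min s t)"

lemma ramp_simps:
  "0 \<le> t \<Longrightarrow> t \<le> s \<Longrightarrow> ramp t s = t"
  "s \<le> 0 \<Longrightarrow> ramp t s = 0"
  "0 \<le> s \<Longrightarrow> s \<le> t \<Longrightarrow> ramp t s = s"
  by (auto simp: ramp_def)

lemma ramp_lipschitz: "\<bar>ramp t s - ramp t s'\<bar> \<le> \<bar>s - s'\<bar>"
  by (auto simp: ramp_def max_def min_def)

lemma has_vector_derivative_ramp:
  assumes "s \<noteq> c" "s \<noteq> c + t" "0 \<le> t"
  shows "((\<lambda>s. ramp t (s - c)) has_vector_derivative indicat_real {c<..<c + t} s) (at s)"
proof -
  consider "s < c" | "c < s" "s < c + t" | "c + t < s" using assms by linarith
  then show ?thesis
  proof cases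
    case 1
    have "((\<lambda>s. 0::real) has_vector_derivative 0) (at s)" by simp
    then have "((\<lambda>s. ramp t (s - c)) has_vector_derivative 0) (at s)"
      by (rule has_vector_derivative_transform_within_open[of _ _ _ "{..<c}"])
        (use 1 in \<open>auto simp: ramp_def\<close>)
    then show ?thesis using 1 by simp
  next
    case 2
    have "((\<lambda>s. s - c) has_vector_derivative 1) (at s)"
      by (auto intro!: derivative_eq_intros)
    then have "((\<lambda>s. ramp t (s - c)) has_vector_derivative 1) (at s)"
      by (rule has_vector_derivative_transform_within_open[of _ _ _ "{c<..<c + t}"])
        (use 2 in \<open>auto simp: ramp_def\<close>)
    then show ?thesis using 2 by simp
  next
    case 3
    have "((\<lambda>s. t) has_vector_derivative 0) (at s)" by simp
    then have "((\<lambda>s. ramp t (s - c)) has_vector_derivative 0) (at s)"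
      by (rule has_vector_derivative_transform_within_open[of _ _ _ "{c + t<..}"])
        (use 3 assms in \<open>auto simp: ramp_def\<close>)
    then show ?thesis using 3 by simp
  qed
qed

lemma abs_continuous_on_lipschitz:
  fixes f :: "real \<Rightarrow> 'a::euclidean_space"
  assumes "0 \<le> B" "\<And>x y. dist (f x) (f y) \<le> B * dist x y"
  shows "abs_continuous_on a b f"
  unfolding abs_continuous_on_def
proof (intro allI impI)
  fix e :: real assume "0 < e"
  show "\<exists>\<delta>>0. \<forall>(m::nat) u v. (\<forall>i<m. a \<le> u i \<and> u i \<le> v i \<and> v i \<le> b) \<longrightarrow>
      disjoint_family_on (\<lambda>i. {u i<..<v i}) {..<m} \<longrightarrow>
      (\<Sum>i<m. v i - u i) < \<delta> \<longrightarrow> (\<Sum>i<m. dist (f (u i)) (f (v i))) < e"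
  proof (intro exI[of _ "e / (B + 1)"] conjI allI impI)
    show "0 < e / (B + 1)" using \<open>0 < e\<close> assms(1) by simp
    fix m :: nat and u v :: "nat \<Rightarrow> real"
    assume uv: "\<forall>i<m. a \<le> u i \<and> u i \<le> v i \<and> v i \<le> b"
      and s: "(\<Sum>i<m. v i - u i) < e / (B + 1)"
    have "(\<Sum>i<m. dist (f (u i)) (f (v i))) \<le> (\<Sum>i<m. B * (v i - u i))"
    proof (rule sum_mono)
      fix i assume "i \<in> {..<m}"
      then have "u i \<le> v i" using uv by simp
      then show "dist (f (u i)) (f (v i)) \<le> B * (v i - u i)"
        using assms(2)[of "u i" "v i"] by (simp add: dist_real_def)
    qed
    also have "\<dots> = B * (\<Sum>i<m. v i - u i)" by (simp add: sum_distrib_left)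
    also have "\<dots> \<le> (B + 1) * (\<Sum>i<m. v i - u i)"
      by (rule mult_right_mono) (use uv in \<open>auto intro!: sum_nonneg\<close>)
    also have "\<dots> < e" using s assms(1) by (simp add: field_simps)
    finally show "(\<Sum>i<m. dist (f (u i)) (f (v i))) < e" .
  qed
qed

text \<open>The half-open intervals single out a step of positive length, although some
  \<open>t l\<close> may vanish.\<close>

lemma partial_sums_cover:
  fixes t :: "nat \<Rightarrow> real"
  assumes "0 \<le> s" "s < (\<Sum>l<k. t l)"
  shows "\<exists>r<k. (\<Sum>l<r. t l) \<le> s \<and> s < (\<Sum>l<Suc r. t l)"
  using assms
proof (induction k)
  case (Suc k)
  then show ?case
    by (cases "s < (\<Sum>l<k. t l)") (auto simp: less_Suc_eq not_less)
qed simp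

text \<open>A path from \<open>y\<close> with velocity \<open>w l\<close> during time
  \<open>t l\<close>. Durations may be zero, as weights of an optimal word may be, so knots may
  coincide.\<close>

locale polygon =
  fixes k :: nat and t :: "nat \<Rightarrow> real" and w :: "nat \<Rightarrow> 'a::euclidean_space" and y :: 'a
  assumes nonneg: "r < k \<Longrightarrow> 0 \<le> t r"
begin

definition knot :: "nat \<Rightarrow> real" where "knot r = (\<Sum>l<r. t l)"

definition curve :: "real \<Rightarrow> 'a" where
  "curve s = y + (\<Sum>l<k. ramp (t l) (s - knot l) *\<^sub>R w l)"

definition vertex :: "nat \<Rightarrow> 'a" where "vertex r = y + (\<Sum>l<r. t l *\<^sub>R w l)"

definition speed :: "real \<Rightarrow> 'a" where
  "speed s = (\<Sum>l<k. indicat_real {knot l<..<knot (Suc l)} s *\<^sub>R w l)"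

lemma knot_Suc: "knot (Suc r) = knot r + t r"
  by (simp add: knot_def)

lemma knot_mono: "r \<le> r' \<Longrightarrow> r' \<le> k \<Longrightarrow> knot r \<le> knot r'"
  unfolding knot_def by (rule sum_mono2) (auto intro: nonneg)

lemma curve_segment:
  assumes r: "r < k" and s: "knot r \<le> s" "s \<le> knot (Suc r)"
  shows "curve s = vertex r + (s - knot r) *\<^sub>R w r"
proof -
  \<comment> \<open>Earlier ramps are complete and contribute whole edges; later ones have not
    begun.\<close>
  have "ramp (t l) (s - knot l) *\<^sub>R w l = (if l < r then t l *\<^sub>R w l else 0) + (if l = r then (s - knot r) *\<^sub>R w r else 0)"
    if "l < k" for l
  proof -
    consider "l < r" | "l = r" | "r < l" by linarith
    then show ?thesis
    proof cases
      case 1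
      then have "knot (Suc l) \<le> knot r" using knot_mono[of "Suc l" r] r by simp
      then show ?thesis using 1 s nonneg[OF that] by (simp add: knot_Suc ramp_simps)
    next
      case 2
      then show ?thesis using s by (simp add: knot_Suc ramp_simps)
    next
      case 3
      then have "knot (Suc r) \<le> knot l" using knot_mono[of "Suc r" l] that by simp
      then show ?thesis using 3 s by (simp add: ramp_simps)
    qed
  qed
  then have "curve s = y + (\<Sum>l<k. (if l < r then t l *\<^sub>R w l else 0) + (if l = r then (s - knot r) *\<^sub>R w r else 0))"
    by (simp add: curve_def)
  also have "(\<Sum>l<k. (if l < r then t l *\<^sub>R w l else 0) + (if l = r then (s - knot r) *\<^sub>R w r else 0))
      = (\<Sum>l<r. t l *\<^sub>R w l) + (s - knot r) *\<^sub>R w r"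
  proof -
    have "{..<k} \<inter> {l. l < r} = {..<r}" using r by auto
    then show ?thesis using r by (simp add: sum.distrib sum.If_cases)
  qed
  finally show ?thesis by (simp add: vertex_def)
qed

lemma speed_segment:
  assumes r: "r < k" and s: "knot r < s" "s < knot (Suc r)"
  shows "speed s = w r"
proof -
  have "indicat_real {knot l<..<knot (Suc l)} s *\<^sub>R w l = (if l = r then w r else 0)" if "l < k" for l
  proof -
    consider "l < r" | "l = r" | "r < l" by linarith
    then show ?thesis
    proof cases
      case 1
      then show ?thesis using knot_mono[of "Suc l" r] r s by simp
    next
      case 3
      then show ?thesis using knot_mono[of "Suc r" l] that s by simp
    qed (use s in simp)
  qed
  then show ?thesis using r by (simp add: speed_def)
qed

lemma curve_derivative:
  assumes "s \<notin> knot ` {..k}"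
  shows "(curve has_vector_derivative speed s) (at s)"
proof -
  have "((\<lambda>s. ramp (t l) (s - knot l) *\<^sub>R w l) has_vector_derivative
      indicat_real {knot l<..<knot (Suc l)} s *\<^sub>R w l) (at s)" if "l < k" for l
  proof -
    have "s \<noteq> knot l" "s \<noteq> knot l + t l"
      using assms that by (auto simp: knot_Suc[symmetric])
    from has_vector_derivative_ramp[OF this nonneg[OF that]]
    show ?thesis
      unfolding knot_Suc
      by (auto simp: has_vector_derivative_def intro!: derivative_eq_intros)
  qed
  then have "((\<lambda>s. \<Sum>l<k. ramp (t l) (s - knot l) *\<^sub>R w l) has_vector_derivative speed s) (at s)"
    unfolding speed_def by (intro has_vector_derivative_sum) auto
  from has_vector_derivative_add[OF has_vector_derivative_const[of y] this]
  show ?thesis by (simp add: curve_def[abs_def])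
qed

lemma curve_lipschitz: "dist (curve s) (curve s') \<le> (\<Sum>l<k. norm (w l)) * dist s s'"
proof -
  have "curve s - curve s' = (\<Sum>l<k. (ramp (t l) (s - knot l) - ramp (t l) (s' - knot l)) *\<^sub>R w l)"
    by (simp add: curve_def sum_subtractf scaleR_diff_left)
  also have "norm \<dots> \<le> (\<Sum>l<k. dist s s' * norm (w l))"
  proof (rule sum_norm_le)
    fix l
    have "\<bar>ramp (t l) (s - knot l) - ramp (t l) (s' - knot l)\<bar> \<le> dist s s'"
      using ramp_lipschitz[of "t l" "s - knot l" "s' - knot l"] by (simp add: dist_real_def)
    then show "norm ((ramp (t l) (s - knot l) - ramp (t l) (s' - knot l)) *\<^sub>R w l) \<le> dist s s' * norm (w l)"
      by (simp add: mult_right_mono)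
  qed
  finally show ?thesis by (simp add: dist_norm sum_distrib_left mult.commute)
qed

lemma abs_continuous_curve: "abs_continuous_on a b curve"
  by (rule abs_continuous_on_lipschitz[OF _ curve_lipschitz]) (simp add: sum_nonneg)

lemma segment_cases:
  assumes "s \<in> {0..knot k}" "s \<notin> knot ` {..k}"
  obtains r where "r < k" "knot r < s" "s < knot (Suc r)" "0 < t r"
proof -
  have "s \<noteq> knot k" using assms(2) by auto
  then have "0 \<le> s" "s < (\<Sum>l<k. t l)" using assms(1) by (auto simp: knot_def)
  from partial_sums_cover[OF this] obtain r where r: "r < k" "knot r \<le> s" "s < knot (Suc r)"
    by (auto simp: knot_def)
  moreover have "s \<noteq> knot r" using assms(2) r(1) by auto
  ultimately show thesis using that[of r] by (simp add: knot_Suc)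
qed

lemma curve_ends:
  assumes "(\<Sum>l<k. t l *\<^sub>R w l) = 0"
  shows "curve 0 = y" "curve (knot k) = y"
proof -
  have "knot 0 = 0" by (simp add: knot_def)
  have "ramp (t l) (0 - knot l) = 0" "ramp (t l) (knot k - knot l) = t l" if "l < k" for l
    using knot_mono[of 0 l] knot_mono[of "Suc l" k] that nonneg[OF that]
    by (auto simp: ramp_simps knot_Suc \<open>knot 0 = 0\<close>)
  then show "curve 0 = y" "curve (knot k) = y"
    using assms by (simp_all add: curve_def)
qed

lemma AE_not_knot: "AE s in lebesgue. s \<notin> knot ` {..k}"
proof -
  have "negligible (knot ` {..k})" by (rule negligible_finite) simp
  then show ?thesis by (auto simp: negligible_iff_null_sets intro: AE_not_in)
qed

text \<open>At the knots the value of \<open>vector_derivative\<close> is not controlled. The knots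
  form a finite set, and changing a function there affects neither its integrability nor its
  integral.\<close>

lemma lebesgue_integral_off_knots:
  fixes f g :: "real \<Rightarrow> real"
  assumes g: "integrable lebesgue g" and eq: "\<And>s. s \<notin> knot ` {..k} \<Longrightarrow> f s = g s"
  shows "integrable lebesgue f" "integral\<^sup>L lebesgue f = integral\<^sup>L lebesgue g"
proof -
  have "has_bochner_integral lebesgue g (integral\<^sup>L lebesgue g) \<longleftrightarrow>
      has_bochner_integral lebesgue f (integral\<^sup>L lebesgue g)"
    by (rule has_bochner_integral_discrete_difference[of "knot ` {..k}"])
      (auto simp: eq countable_finite)
  with g show "integrable lebesgue f" "integral\<^sup>L lebesgue f = integral\<^sup>L lebesgue g"
    by (auto simp: has_bochner_integral_iff)
qed

lemma integral_segments:
  fixes c :: "nat \<Rightarrow> real" and f :: "real \<Rightarrow> real"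
  assumes f: "\<And>r s. r < k \<Longrightarrow> knot r < s \<Longrightarrow> s < knot (Suc r) \<Longrightarrow> f s = c r"
  shows "set_integrable lebesgue {0..knot k} f"
    "(LINT s:{0..knot k}|lebesgue. f s) = (\<Sum>r<k. t r * c r)"
proof -
  let ?g = "\<lambda>s. \<Sum>r<k. indicat_real {knot r<..<knot (Suc r)} s * c r"
  have 1: "has_bochner_integral lebesgue (\<lambda>s. indicat_real {knot r<..<knot (Suc r)} s * c r) (t r * c r)"
    if "r < k" for r
    using nonneg[OF that]
    by (intro has_bochner_integral_mult_left)
      (auto simp: has_bochner_integral_iff knot_Suc intro!: integrable_real_indicator)
  have 2: "has_bochner_integral lebesgue ?g (\<Sum>r<k. t r * c r)"
    by (rule has_bochner_integral_sum) (use 1 in auto)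
  have eq: "indicat_real {0..knot k} s *\<^sub>R f s = ?g s" if s: "s \<notin> knot ` {..k}" for s
  proof (cases "s \<in> {0..knot k}")
    case True
    then obtain r where r: "r < k" "knot r < s" "s < knot (Suc r)"
      using segment_cases[OF _ s] by blast
    have "indicat_real {knot l<..<knot (Suc l)} s * c l = (if l = r then c r else 0)" if "l < k" for l
    proof -
      consider "l < r" | "l = r" | "r < l" by linarith
      then show ?thesis
      proof cases
        case 1
        then show ?thesis using knot_mono[of "Suc l" r] r by simp
      next
        case 3
        then show ?thesis using knot_mono[of "Suc r" l] that r by simp
      qed (use r in simp)
    qed
    then have "?g s = c r" using r(1) by simp
    then show ?thesis using f[OF r] True by simp
  next
    case False
    have "knot 0 = 0" by (simp add: knot_def)
    have "indicat_real {knot l<..<knot (Suc l)} s = 0" if "l < k" for l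
      using knot_mono[of 0 l] knot_mono[of "Suc l" k] that False \<open>knot 0 = 0\<close>
      by (auto simp: indicator_def)
    then show ?thesis using False by simp
  qed
  note off = lebesgue_integral_off_knots[OF _ eq]
  show "set_integrable lebesgue {0..knot k} f"
    unfolding set_integrable_def by (rule off(1)) (use 2 in \<open>auto simp: has_bochner_integral_iff\<close>)
  show "(LINT s:{0..knot k}|lebesgue. f s) = (\<Sum>r<k. t r * c r)"
    unfolding set_lebesgue_integral_def
    by (subst off(2)) (use 2 in \<open>auto simp: has_bochner_integral_iff\<close>)
qed

lemma curve_derivative_segment:
  assumes "r < k" "knot r < s" "s < knot (Suc r)"
  shows "(curve has_vector_derivative w r) (at s)" "vector_derivative curve (at s) = w r"
proof -
  have "s \<notin> knot ` {..k}"
  proof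
    assume "s \<in> knot ` {..k}"
    then obtain l where l: "l \<le> k" "s = knot l" by auto
    then show False
      using knot_mono[of l r] knot_mono[of "Suc r" l] assms by (cases "l \<le> r") auto
  qed
  from curve_derivative[OF this] show "(curve has_vector_derivative w r) (at s)"
    by (simp add: speed_segment[OF assms])
  then show "vector_derivative curve (at s) = w r" by (rule vector_derivative_at)
qed

end

text \<open>An edge that starts on the hyperplane \<open>n r \<bullet> z = c r\<close> stays on it,
  because a vector is orthogonal to its rotation. Hence the edge runs in the boundary with
  \<open>n r\<close> as an outer normal. Along it, position and velocity pair to
  \<open>\<kappa> * c r\<close>, which gives the action.\<close>

lemma polygon_closed_characteristic:
  fixes n :: "nat \<Rightarrow> 'a::euclidean_space \<times> 'a" and C :: "('a \<times> 'a) set"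
  assumes C: "convex C" "closed C" and t: "\<And>r. r < k \<Longrightarrow> 0 \<le> t r" and \<kappa>: "0 < \<kappa>"
    and loop: "(\<Sum>r<k. t r *\<^sub>R n r) = 0" and pos: "0 < (\<Sum>r<k. t r)"
    and supp: "\<And>r z. r < k \<Longrightarrow> z \<in> C \<Longrightarrow> n r \<bullet> z \<le> c r" and nz: "\<And>r. r < k \<Longrightarrow> n r \<noteq> 0"
    and vert: "\<And>r. r \<le> k \<Longrightarrow> p + (\<Sum>l<r. (\<kappa> * t l) *\<^sub>R complex_str (n l)) \<in> C"
    and facet: "\<And>r. r < k \<Longrightarrow> 0 < t r \<Longrightarrow>
      n r \<bullet> (p + (\<Sum>l<r. (\<kappa> * t l) *\<^sub>R complex_str (n l))) = c r"
  shows "\<exists>\<gamma>. closed_characteristic C (\<Sum>r<k. t r) \<gamma> \<and>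
    sympl_action (\<Sum>r<k. t r) \<gamma> = (\<kappa> / 2) * (\<Sum>r<k. t r * c r)"
proof -
  interpret polygon k t "\<lambda>r. \<kappa> *\<^sub>R complex_str (n r)" p
    by unfold_locales (rule t)
  have vertex: "vertex r = p + (\<Sum>l<r. (\<kappa> * t l) *\<^sub>R complex_str (n l))" for r
    by (simp add: vertex_def mult.commute)
  have T: "(\<Sum>r<k. t r) = knot k" by (simp add: knot_def)
  have "(\<Sum>r<k. t r *\<^sub>R \<kappa> *\<^sub>R complex_str (n r)) = \<kappa> *\<^sub>R complex_str (\<Sum>r<k. t r *\<^sub>R n r)"
    by (simp add: linear_sum[OF linear_complex_str] linear_cmul[OF linear_complex_str] scaleR_sum_right mult.commute)
  also have "\<dots> = 0" by (simp add: loop)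
  finally have ends: "curve 0 = p" "curve (knot k) = p" using curve_ends by auto
  have in_C: "curve s \<in> C" and on_facet: "n r \<bullet> curve s = c r"
    if "r < k" "knot r \<le> s" "s \<le> knot (Suc r)" "0 < t r" for r s
  proof -
    define u where "u = (s - knot r) / t r"
    have u: "0 \<le> u" "u \<le> 1" "s - knot r = u * t r"
      using that by (auto simp: u_def knot_Suc field_simps)
    have curve_s: "curve s = vertex r + (s - knot r) *\<^sub>R \<kappa> *\<^sub>R complex_str (n r)"
      by (rule curve_segment[OF that(1-3)])
    also have "\<dots> = (1 - u) *\<^sub>R vertex r + u *\<^sub>R vertex (Suc r)"
      by (simp add: vertex_def u(3) algebra_simps)
    also have "\<dots> \<in> C"
      using u vert[of r] vert[of "Suc r"] that(1) by (intro convexD[OF C(1)]) (auto simp: vertex)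
    finally show "curve s \<in> C" .
    show "n r \<bullet> curve s = c r"
      using facet[OF that(1,4)] by (simp add: curve_s inner_add_right inner_complex_str vertex)
  qed
  have front: "curve s \<in> frontier C" if "r < k" "knot r \<le> s" "s \<le> knot (Suc r)" "0 < t r" for r s
  proof -
    have "curve s \<notin> interior C"
    proof
      assume "curve s \<in> interior C"
      then have "curve s \<in> interior {z. n r \<bullet> z \<le> c r}"
        using interior_mono[of C "{z. n r \<bullet> z \<le> c r}"] supp[OF that(1)] by blast
      then show False using nz[OF that(1)] on_facet[OF that] by simp
    qed
    then show ?thesis using in_C[OF that] C(2) by (simp add: frontier_def)
  qed
  have start: "\<exists>r<k. knot r \<le> s \<and> s \<le> knot (Suc r) \<and> 0 < t r" if "0 \<le> s" "s < knot k" for s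
    using partial_sums_cover[OF that(1), of t k] that(2) by (fastforce simp: knot_def)
  have cc: "closed_characteristic C (knot k) curve"
    unfolding closed_characteristic_def
  proof (intro conjI)
    show "0 < knot k" using pos T by simp
    show "curve ` {0..knot k} \<subseteq> frontier C"
    proof
      fix z assume "z \<in> curve ` {0..knot k}"
      then obtain s where s: "0 \<le> s" "s \<le> knot k" "z = curve s" by auto
      \<comment> \<open>The covering by edges omits the final time, whose point is also reached at
        time zero.\<close>
      then have "\<exists>s'. 0 \<le> s' \<and> s' < knot k \<and> z = curve s'"
        using ends \<open>0 < knot k\<close> by (cases "s = knot k") auto
      then show "z \<in> frontier C" using start front by blast
    qed
    show "curve 0 = curve (knot k)" by (simp add: ends)
    show "\<not> curve constant_on {0..knot k}"
    proof
      assume "curve constant_on {0..knot k}"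
      then obtain z where z: "\<And>s. s \<in> {0..knot k} \<Longrightarrow> curve s = z" by (auto simp: constant_on_def)
      \<comment> \<open>An edge of positive duration has distinct end points, since
        \<open>\<kappa>\<close> and \<open>n r\<close> do not vanish.\<close>
      obtain r where r: "r < k" "0 < t r" using start[of 0] \<open>0 < knot k\<close> by auto
      have kn: "knot 0 = 0" "knot 0 \<le> knot r" "knot r \<le> knot (Suc r)" "knot (Suc r) \<le> knot k"
        using knot_mono[of 0 r] knot_mono[of r "Suc r"] knot_mono[of "Suc r" k] r
        by (auto simp: knot_def)
      then have "curve (knot r) = curve (knot (Suc r))" using z by auto
      then have "t r *\<^sub>R \<kappa> *\<^sub>R complex_str (n r) = 0"
        using curve_segment[OF r(1), of "knot r"] curve_segment[OF r(1), of "knot (Suc r)"] kn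
        by (simp add: knot_Suc)
      then show False using r nz[OF r(1)] \<kappa> by simp
    qed
    show "abs_continuous_on 0 (knot k) curve" by (rule abs_continuous_curve)
    show "set_integrable lebesgue {0..knot k} (\<lambda>s. (norm (vector_derivative curve (at s)))\<^sup>2)"
      by (rule integral_segments(1)[where c = "\<lambda>r. (norm (\<kappa> *\<^sub>R complex_str (n r)))\<^sup>2"])
        (simp add: curve_derivative_segment(2))
    show "AE s in lebesgue. s \<in> {0..knot k} \<longrightarrow> curve differentiable (at s) \<and>
        vector_derivative curve (at s) \<in> complex_str ` outer_normal_cone C (curve s)"
      using AE_not_knot
    proof (rule AE_mp, intro AE_I2 impI)
      fix s assume "s \<notin> knot ` {..k}" "s \<in> {0..knot k}"
      then obtain r where r: "r < k" "knot r < s" "s < knot (Suc r)" "0 < t r"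
        using segment_cases by blast
      have "\<kappa> *\<^sub>R n r \<in> outer_normal_cone C (curve s)"
        using supp[OF r(1)] on_facet[of r s] r \<kappa>
        by (auto simp: outer_normal_cone_def inner_diff_right intro!: mult_nonneg_nonpos)
      moreover have "vector_derivative curve (at s) = complex_str (\<kappa> *\<^sub>R n r)"
        using curve_derivative_segment(2)[OF r(1-3)] by (simp add: linear_cmul[OF linear_complex_str])
      ultimately show "curve differentiable (at s) \<and>
          vector_derivative curve (at s) \<in> complex_str ` outer_normal_cone C (curve s)"
        using curve_derivative_segment(1)[OF r(1-3)] by (auto intro: differentiableI_vector)
    qed
  qed
  have "(LINT s:{0..knot k}|lebesgue. sympl_form (curve s) (vector_derivative curve (at s)))
      = (\<Sum>r<k. t r * (\<kappa> * c r))"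
  proof (rule integral_segments(2))
    fix r s assume rs: "r < k" "knot r < s" "s < knot (Suc r)"
    then have "0 < t r" by (simp add: knot_Suc)
    then show "sympl_form (curve s) (vector_derivative curve (at s)) = \<kappa> * c r"
      using on_facet[of r s] rs
      by (simp add: curve_derivative_segment(2)[OF rs] sympl.scaleR_right
          inner_eq_sympl_form[symmetric] inner_commute)
  qed
  also have "\<dots> = \<kappa> * (\<Sum>r<k. t r * c r)" by (simp add: sum_distrib_left mult.left_commute)
  finally have "sympl_action (knot k) curve = (\<kappa> / 2) * (\<Sum>r<k. t r * c r)"
    by (simp add: sympl_action_def)
  with cc show ?thesis unfolding T by blast
qed

section \<open>Polytopes and their products\<close>

text \<open>For closed words the cost does not depend on the origin, so the origin may be moved into
  the interior, where all costs of letters are positive.\<close>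

lemma cost_translate: "cost (\<lambda>i. c i - n i \<bullet> z) L = cost c L - sum_list (velocities n L) \<bullet> z"
  by (induction L) (simp_all add: algebra_simps inner_add_left)

text \<open>The optimal loop has a form \<open>q\<close> at least that of \<open>L\<close>; scaled
  by \<open>1 / q\<close> and translated into \<open>C\<close>, it becomes a closed characteristic
  of action \<open>1 / (2 * q)\<close>.\<close>

lemma ehz_capacity_le_word_form:
  fixes n :: "'i \<Rightarrow> 'a::euclidean_space \<times> 'a"
  assumes fin: "finite I" and C: "C = {z. \<forall>i\<in>I. n i \<bullet> z \<le> c i}"
    and z0: "\<And>i. i \<in> I \<Longrightarrow> n i \<bullet> z0 < c i" and nz: "\<And>i. i \<in> I \<Longrightarrow> n i \<noteq> 0"
    and L: "nonneg_word I L" "sum_list (velocities n L) = 0" "0 < word_form (velocities n L)"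
      "cost c L = 1"
  shows "ehz_capacity C \<le> ereal (1 / (2 * word_form (velocities n L)))"
proof -
  define d where "d i = c i - n i \<bullet> z0" for i
  have d: "0 < d i" if "i \<in> I" for i using z0[OF that] by (simp add: d_def)
  have cost_d: "cost d L = 1" using L(2,4) by (simp add: d_def[abs_def] cost_translate)
  have "\<exists>(k::nat) i t q b. word_form (velocities n L) \<le> q \<and> (\<forall>r<k. i r \<in> I \<and> 0 \<le> t r) \<and>
      (\<Sum>r<k. t r * d (i r)) = 1 \<and> (\<Sum>r<k. t r *\<^sub>R n (i r)) = 0 \<and>
      (\<forall>r\<le>k. \<forall>j\<in>I. sympl_form (\<Sum>l<r. t l *\<^sub>R n (i l)) (n j) + b \<bullet> n j \<le> q * d j) \<and>
      (\<forall>r<k. 0 < t r \<longrightarrow>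
        sympl_form (\<Sum>l<r. t l *\<^sub>R n (i l)) (n (i r)) + b \<bullet> n (i r) = q * d (i r))"
    by (rule optimal_loop[OF fin _ L(1-3) cost_d]) (rule d)
  then obtain k :: nat and i t q b where q: "word_form (velocities n L) \<le> q"
    and it: "\<forall>r<k. i r \<in> I \<and> 0 \<le> t r"
    and cost: "(\<Sum>r<k. t r * d (i r)) = 1" and loop: "(\<Sum>r<k. t r *\<^sub>R n (i r)) = 0"
    and le: "\<forall>r\<le>k. \<forall>j\<in>I.
      sympl_form (\<Sum>l<r. t l *\<^sub>R n (i l)) (n j) + b \<bullet> n j \<le> q * d j"
    and eq: "\<forall>r<k. 0 < t r \<longrightarrow>
      sympl_form (\<Sum>l<r. t l *\<^sub>R n (i l)) (n (i r)) + b \<bullet> n (i r) = q * d (i r)"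
    by (elim exE conjE)
  have i: "i r \<in> I" and t: "0 \<le> t r" if "r < k" for r using it that by auto
  have "0 < q" using q L(3) by linarith
  \<comment> \<open>The shift \<open>z0\<close> undoes the change of origin, and \<open>b\<close> is
    the multiplier, scaled like the polygon; with this starting point the junction inequalities say
    that the vertices \<open>V r\<close> lie in \<open>C\<close>.\<close>
  define z1 where "z1 = z0 + (1 / q) *\<^sub>R b"
  define V where "V r = z1 + (\<Sum>l<r. (1 / q * t l) *\<^sub>R complex_str (n (i l)))" for r
  have V: "n j \<bullet> V r = n j \<bullet> z0 + (sympl_form (\<Sum>l<r. t l *\<^sub>R n (i l)) (n j) + b \<bullet> n j) / q" for j r
    by (simp add: V_def z1_def inner_add_right inner_sum_right inner_complex_str sympl.sum_left
        sympl.scaleR_left add_divide_distrib sum_divide_distrib inner_commute)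
  have pos: "0 < (\<Sum>r<k. t r)"
  proof (rule ccontr)
    assume "\<not> 0 < (\<Sum>r<k. t r)"
    then have "(\<Sum>r<k. t r) = 0" using sum_nonneg[of "{..<k}" t] t by force
    then have "\<And>r. r < k \<Longrightarrow> t r = 0" using sum_nonneg_eq_0_iff[of "{..<k}" t] t by auto
    then show False using cost by simp
  qed
  have "(\<Sum>r<k. t r * c (i r)) = (\<Sum>r<k. t r * d (i r)) + (\<Sum>r<k. t r *\<^sub>R n (i r)) \<bullet> z0"
    by (simp add: d_def right_diff_distrib sum_subtractf inner_sum_left)
  then have cost_c: "(\<Sum>r<k. t r * c (i r)) = 1" by (simp add: cost loop)
  have "\<exists>\<gamma>. closed_characteristic C (\<Sum>r<k. t r) \<gamma> \<and>
      sympl_action (\<Sum>r<k. t r) \<gamma> = (1 / q / 2) * (\<Sum>r<k. t r * c (i r))"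
  proof (rule polygon_closed_characteristic[where p = z1])
    have "C = (\<Inter>i\<in>I. {z. n i \<bullet> z \<le> c i})" by (auto simp: C)
    then show "convex C" "closed C"
      by (auto intro!: convex_INT closed_INT convex_halfspace_le closed_halfspace_le)
    show "0 < 1 / q" using \<open>0 < q\<close> by simp
    show "n (i r) \<bullet> z \<le> c (i r)" if "r < k" "z \<in> C" for r z using that i by (auto simp: C)
    show "z1 + (\<Sum>l<r. (1 / q * t l) *\<^sub>R complex_str (n (i l))) \<in> C" if "r \<le> k" for r
      unfolding C V_def[symmetric]
      using le that \<open>0 < q\<close> by (auto simp: V d_def field_simps)
    show "n (i r) \<bullet> (z1 + (\<Sum>l<r. (1 / q * t l) *\<^sub>R complex_str (n (i l)))) = c (i r)"
      if "r < k" "0 < t r" for r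
      unfolding V_def[symmetric] V using eq that \<open>0 < q\<close> by (simp add: d_def)
  qed (use t i nz loop pos in auto)
  then obtain \<gamma> where "closed_characteristic C (\<Sum>r<k. t r) \<gamma>"
    "sympl_action (\<Sum>r<k. t r) \<gamma> = 1 / (2 * q)"
    by (auto simp: cost_c)
  then have "ehz_capacity C \<le> ereal (1 / (2 * q))"
    unfolding ehz_capacity_def by (intro Inf_lower) (auto intro!: exI)
  also have "\<dots> \<le> ereal (1 / (2 * word_form (velocities n L)))"
    using q L(3) by (simp add: frac_le)
  finally show ?thesis .
qed

text \<open>The affine hull of a facet lies in a supporting hyperplane and has the same dimension,
  as \<open>K\<close> is full-dimensional, so the two coincide. Dividing by \<open>norm a\<close>
  makes the normal a unit vector.\<close>

lemma facet_supporting_hyperplane: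
  fixes K :: "'a::euclidean_space set"
  assumes K: "polyhedron K" "interior K \<noteq> {}" and F: "F facet_of K"
  obtains a b where "norm a = 1" "affine hull F = {x. a \<bullet> x = b}" "K \<subseteq> {x. a \<bullet> x \<le> b}"
proof -
  obtain a b where ab: "a \<noteq> 0" "K \<subseteq> {x. a \<bullet> x \<le> b}" "F = K \<inter> {x. a \<bullet> x = b}"
    using facet_of_polyhedron[OF K(1) F] by blast
  have "aff_dim F = DIM('a) - 1"
    using F K(2) by (simp add: facet_of_def aff_dim_nonempty_interior)
  moreover have "affine hull F \<subseteq> {x. a \<bullet> x = b}"
    by (rule hull_minimal) (auto simp: ab(3) affine_hyperplane)
  ultimately have "affine hull F = {x. a \<bullet> x = b}"
    using F ab(1) by (intro affine_dim_equal) (auto simp: affine_hyperplane facet_of_def)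
  moreover have "{x. a \<bullet> x = b} = {x. (a /\<^sub>R norm a) \<bullet> x = b / norm a}"
    "{x. a \<bullet> x \<le> b} = {x. (a /\<^sub>R norm a) \<bullet> x \<le> b / norm a}"
    using ab(1) by (auto simp: field_simps)
  ultimately show thesis
    using ab by (intro that[of "a /\<^sub>R norm a" "b / norm a"]) auto
qed

text \<open>A segment from an interior point to a point outside \<open>K\<close> crosses the
  frontier, which is the union of the facets. At the crossing the inequality of some facet is an
  equality; it is strict at the interior end, so it must fail at the other end.\<close>

lemma polyhedron_facet_normals:
  fixes K :: "'a::euclidean_space set"
  assumes K: "polyhedron K" "interior K \<noteq> {}"
  shows "\<exists>n c. (\<forall>F. F facet_of K \<longrightarrow> norm (n F) = 1 \<and> affine hull F = {x. n F \<bullet> x = c F} \<and>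
      (\<forall>x\<in>interior K. n F \<bullet> x < c F)) \<and>
    K = {x. \<forall>F. F facet_of K \<longrightarrow> n F \<bullet> x \<le> c F}"
proof -
  have "\<exists>n c. norm n = 1 \<and> affine hull F = {x. n \<bullet> x = c} \<and> K \<subseteq> {x. n \<bullet> x \<le> c}"
    if "F facet_of K" for F
    using facet_supporting_hyperplane[OF K that] by metis
  then obtain n c where nc: "\<And>F. F facet_of K \<Longrightarrow> norm (n F) = 1"
    "\<And>F. F facet_of K \<Longrightarrow> affine hull F = {x. n F \<bullet> x = c F}"
    "\<And>F. F facet_of K \<Longrightarrow> K \<subseteq> {x. n F \<bullet> x \<le> c F}" by metis
  have int: "n F \<bullet> x < c F" if F: "F facet_of K" and x: "x \<in> interior K" for F x
  proof -
    have "x \<in> interior {x. n F \<bullet> x \<le> c F}" using interior_mono[OF nc(3)[OF F]] x by blast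
    moreover have "n F \<noteq> 0" using nc(1)[OF F] by auto
    ultimately show ?thesis by simp
  qed
  have "x \<in> K" if x: "\<And>F. F facet_of K \<Longrightarrow> n F \<bullet> x \<le> c F" for x
  proof (rule ccontr)
    assume "x \<notin> K"
    obtain y where y: "y \<in> interior K" using K(2) by blast
    then have "y \<in> K" using interior_subset by blast
    then have "closed_segment y x \<inter> frontier K \<noteq> {}"
      using \<open>x \<notin> K\<close> by (intro connected_Int_frontier) auto
    then obtain z where z: "z \<in> closed_segment y x" "z \<in> frontier K" by blast
    then have "z \<in> K" using polyhedron_imp_closed[OF K(1)] by (auto simp: frontier_def)
    have "rel_frontier K = frontier K"
      by (rule rel_frontier_frontier[OF affine_hull_nonempty_interior[OF K(2)]])
    with z(2) obtain F where F: "F facet_of K" "z \<in> F"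
      using rel_frontier_of_polyhedron[OF K(1)] by blast
    then have "n F \<bullet> z = c F" using nc(2)[OF F(1)] hull_inc[of z F affine] by blast
    moreover obtain u where u: "0 \<le> u" "u \<le> 1" "z = (1 - u) *\<^sub>R y + u *\<^sub>R x"
      using z(1) by (auto simp: in_segment)
    moreover have "u \<noteq> 1" using u(3) \<open>z \<in> K\<close> \<open>x \<notin> K\<close> by auto
    moreover have "(1 - u) * (n F \<bullet> y) < (1 - u) * c F"
      using int[OF F(1) y] u \<open>u \<noteq> 1\<close> by simp
    moreover have "u * (n F \<bullet> x) \<le> u * c F"
      using x[OF F(1)] u by (simp add: mult_left_mono)
    ultimately show False by (simp add: inner_add_right algebra_simps)
  qed
  then have K_eq: "K = {x. \<forall>F. F facet_of K \<longrightarrow> n F \<bullet> x \<le> c F}"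
    using nc(3) by blast
  show ?thesis by (intro exI[of _ n] exI[of _ c] conjI K_eq allI impI ballI nc(1,2) int)
qed

text \<open>Apply \<open>farkas\<close> with right-hand side \<open>1\<close>: a vector
  \<open>b\<close> with \<open>1 \<le> n i \<bullet> b\<close> for all \<open>i\<close> would make
  \<open>- b\<close> a direction of recession of the bounded set \<open>K\<close>.\<close>

lemma bounded_imp_positive_dependence:
  fixes n :: "'i \<Rightarrow> 'a::euclidean_space"
  assumes fin: "finite I" and K: "bounded K" "K = {x. \<forall>i\<in>I. n i \<bullet> x \<le> c i}" "K \<noteq> {}"
  obtains l where "\<And>i. i \<in> I \<Longrightarrow> 0 \<le> l i" "(\<Sum>i\<in>I. l i *\<^sub>R n i) = 0" "0 < (\<Sum>i\<in>I. l i)"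
proof -
  have "\<not> (\<forall>i\<in>I. 1 \<le> n i \<bullet> b)" for b
  proof
    assume b: "\<forall>i\<in>I. 1 \<le> n i \<bullet> b"
    have "K \<noteq> UNIV" using K(1) not_bounded_UNIV by blast
    then have "I \<noteq> {}" using K(2) by auto
    then have "b \<noteq> 0" using b by auto
    obtain y where y: "y \<in> K" using K(3) by blast
    obtain B where B: "\<And>x. x \<in> K \<Longrightarrow> norm x \<le> B" using K(1) bounded_iff by metis
    \<comment> \<open>With this length the point \<open>y - s *\<^sub>R b\<close> has norm at least
      \<open>B + 1\<close>.\<close>
    define s where "s = (B + norm y + 1) / norm b"
    have "0 \<le> s" using order_trans[OF norm_ge_zero B[OF y]] by (simp add: s_def)
    have "y - s *\<^sub>R b \<in> K"
      unfolding K(2)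
    proof safe
      fix i assume i: "i \<in> I"
      have "0 \<le> s * (n i \<bullet> b)" using b i \<open>0 \<le> s\<close> by (force intro: mult_nonneg_nonneg)
      then show "n i \<bullet> (y - s *\<^sub>R b) \<le> c i" using y i by (simp add: K(2) inner_diff_right) force
    qed
    then have "norm (y - s *\<^sub>R b) \<le> B" by (rule B)
    moreover have "norm (s *\<^sub>R b) = B + norm y + 1"
      using order_trans[OF norm_ge_zero B[OF y]] \<open>b \<noteq> 0\<close> by (simp add: s_def)
    ultimately show False using norm_triangle_ineq2[of "s *\<^sub>R b" y] by (simp add: norm_minus_commute)
  qed
  then obtain l where l: "\<forall>i\<in>I. 0 \<le> l i" "(\<Sum>i\<in>I. l i *\<^sub>R n i) = 0" "0 < (\<Sum>i\<in>I. l i * 1)"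
    using farkas[OF fin, of "\<lambda>_. 1" n] by blast
  show thesis by (rule that[of l]) (use l in simp_all)
qed

section \<open>Facet normals of the product and the test word\<close>

definition product_normal :: "('f \<Rightarrow> 'a::zero) \<Rightarrow> 'f \<times> bool \<Rightarrow> 'a \<times> 'a" where
  "product_normal n i = (if snd i then (0, n (fst i)) else (n (fst i), 0))"

text \<open>
  Placing the \<open>q\<close>- and the \<open>p\<close>-copy of each normal next to each other makes the contributions of
  distinct facets cancel, so that only the squares \<open>(l F)\<^sup>2\<close> remain in the form.
\<close>

definition product_word :: "('f \<Rightarrow> real) \<Rightarrow> 'f list \<Rightarrow> ('f \<times> bool) word" where
  "product_word l Fs = concat (map (\<lambda>F. [((F, False), l F), ((F, True), l F)]) Fs)"

text \<open>The two letters of a facet add up to a vector of the diagonal, which is a Lagrangian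
  subspace. Blocks of different facets therefore pair to zero, and only the pairing within each
  block is left.\<close>

lemma product_word:
  fixes n :: "'f \<Rightarrow> 'a::euclidean_space"
  shows "sum_list (velocities (product_normal n) (product_word l Fs)) =
      (\<Sum>F\<leftarrow>Fs. l F *\<^sub>R n F, \<Sum>F\<leftarrow>Fs. l F *\<^sub>R n F)"
    "word_form (velocities (product_normal n) (product_word l Fs)) = (\<Sum>F\<leftarrow>Fs. (l F)\<^sup>2 * (n F \<bullet> n F))"
    "cost (c \<circ> fst) (product_word l Fs) = 2 * (\<Sum>F\<leftarrow>Fs. l F * c F)"
proof -
  show s: "sum_list (velocities (product_normal n) (product_word l Fs)) =
      (\<Sum>F\<leftarrow>Fs. l F *\<^sub>R n F, \<Sum>F\<leftarrow>Fs. l F *\<^sub>R n F)" for Fs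
    by (induction Fs) (simp_all add: product_word_def product_normal_def zero_prod_def)
  show "word_form (velocities (product_normal n) (product_word l Fs)) = (\<Sum>F\<leftarrow>Fs. (l F)\<^sup>2 * (n F \<bullet> n F))"
  proof (induction Fs)
    case (Cons F Fs)
    have "product_word l (F # Fs) = ((F, False), l F) # ((F, True), l F) # product_word l Fs"
      by (simp add: product_word_def)
    then show ?case
      using Cons by (simp add: s)
        (simp add: product_normal_def sympl_form_def inner_add_right power2_eq_square algebra_simps)
  qed (simp add: product_word_def)
  show "cost (c \<circ> fst) (product_word l Fs) = 2 * (\<Sum>F\<leftarrow>Fs. l F * c F)"
    by (induction Fs) (simp_all add: product_word_def)
qed

lemma infdist_hyperplane_ge:
  fixes a :: "'a::euclidean_space"
  assumes "norm a = 1"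
  shows "b - a \<bullet> x \<le> infdist x {x. a \<bullet> x = b}"
proof -
  \<comment> \<open>The hyperplane has to be shown non-empty, because \<open>infdist\<close> to the
    empty set is \<open>0\<close> by convention.\<close>
  have "b *\<^sub>R a \<in> {x. a \<bullet> x = b}" using assms by (simp add: dot_square_norm)
  then have ne: "{x. a \<bullet> x = b} \<noteq> {}" by blast
  have "b - a \<bullet> x \<le> dist x y" if "a \<bullet> y = b" for y
  proof -
    have "b - a \<bullet> x = a \<bullet> (y - x)" using that by (simp add: inner_diff_right)
    also have "\<dots> \<le> norm a * norm (y - x)" by (rule norm_cauchy_schwarz)
    finally show ?thesis using assms by (simp add: dist_norm norm_minus_commute)
  qed
  then show ?thesis
    unfolding infdist_notempty[OF ne] by (intro cINF_greatest ne) simp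
qed

theorem corollary1p6:
  fixes K :: "((real ^ 'n) \<times> (real ^ 'n)) set"
  assumes "polytope K" and "interior K \<noteq> {}"
  shows "ehz_capacity (K \<times>\<^sub>L K)
    \<le> ereal (2 * (INF x\<in>K. \<Sum>F | F facet_of K. (infdist x (affine hull F))\<^sup>2))"
proof -
  define \<F> where "\<F> = {F. F facet_of K}"
  have poly: "polyhedron K" using assms(1) by (rule polytope_imp_polyhedron)
  have fin: "finite \<F>" unfolding \<F>_def by (rule finite_polyhedron_facets[OF poly])
  obtain n c where "(\<forall>F. F facet_of K \<longrightarrow> norm (n F) = 1 \<and> affine hull F = {x. n F \<bullet> x = c F} \<and>
      (\<forall>x\<in>interior K. n F \<bullet> x < c F)) \<and>
    K = {x. \<forall>F. F facet_of K \<longrightarrow> n F \<bullet> x \<le> c F}"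
    using polyhedron_facet_normals[OF poly assms(2)] by (elim exE)
  then have nc: "\<And>F. F facet_of K \<Longrightarrow> norm (n F) = 1"
    "\<And>F. F facet_of K \<Longrightarrow> affine hull F = {x. n F \<bullet> x = c F}"
    "K = {x. \<forall>F. F facet_of K \<longrightarrow> n F \<bullet> x \<le> c F}"
    "\<And>F x. F facet_of K \<Longrightarrow> x \<in> interior K \<Longrightarrow> n F \<bullet> x < c F"
    by blast+
  have K: "K = {x. \<forall>F\<in>\<F>. n F \<bullet> x \<le> c F}" using nc(3) by (simp add: \<F>_def)
  obtain y where y: "y \<in> interior K" using assms(2) by blast
  have "y \<in> K" using y interior_subset by blast
  obtain l where l: "\<And>F. F \<in> \<F> \<Longrightarrow> 0 \<le> l F" "(\<Sum>F\<in>\<F>. l F *\<^sub>R n F) = 0" "0 < (\<Sum>F\<in>\<F>. l F)"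
    using bounded_imp_positive_dependence[OF fin polytope_imp_bounded[OF assms(1)] K] \<open>y \<in> K\<close> by auto
  \<comment> \<open>The dependence between the normals makes the weighted sum of distances to the
    facet hyperplanes the same at every point.\<close>
  have shift: "(\<Sum>F\<in>\<F>. l F * (c F - n F \<bullet> x)) = (\<Sum>F\<in>\<F>. l F * c F)" for x
  proof -
    have "(\<Sum>F\<in>\<F>. l F * (c F - n F \<bullet> x)) = (\<Sum>F\<in>\<F>. l F * c F) - (\<Sum>F\<in>\<F>. l F *\<^sub>R n F) \<bullet> x"
      by (simp add: right_diff_distrib sum_subtractf inner_sum_left)
    then show ?thesis by (simp add: l(2))
  qed
  obtain F0 where F0: "F0 \<in> \<F>" "0 < l F0"
    using l(3) sum_nonpos[of \<F> l] by (meson not_le)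
  \<comment> \<open>At the interior point \<open>y\<close> all these distances are positive, so the
    common value is positive.\<close>
  have "0 < l F0 * (c F0 - n F0 \<bullet> y)" using F0 nc(4)[OF _ y] by (simp add: \<F>_def)
  also have "\<dots> \<le> (\<Sum>F\<in>\<F>. l F * (c F - n F \<bullet> y))"
    using fin F0 l(1) nc(4)[OF _ y] by (intro member_le_sum) (auto simp: \<F>_def less_imp_le)
  finally have pos: "0 < (\<Sum>F\<in>\<F>. l F * c F)" by (simp add: shift)
  \<comment> \<open>Each facet occurs twice in the product word, once per factor, so the weighted
    sum is normalized to \<open>1 / 2\<close> to give the word cost \<open>1\<close>.\<close>
  define \<beta> where "\<beta> F = l F / (2 * (\<Sum>F\<in>\<F>. l F * c F))" for F
  have \<beta>: "0 \<le> \<beta> F" if "F \<in> \<F>" for F using l(1)[OF that] pos by (simp add: \<beta>_def)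
  have \<beta>n: "(\<Sum>F\<in>\<F>. \<beta> F *\<^sub>R n F) = 0"
  proof -
    have "(\<Sum>F\<in>\<F>. \<beta> F *\<^sub>R n F) = (1 / (2 * (\<Sum>F\<in>\<F>. l F * c F))) *\<^sub>R (\<Sum>F\<in>\<F>. l F *\<^sub>R n F)"
      unfolding scaleR_sum_right by (simp add: \<beta>_def)
    then show ?thesis by (simp add: l(2))
  qed
  have \<beta>c: "(\<Sum>F\<in>\<F>. \<beta> F * (c F - n F \<bullet> x)) = 1 / 2" for x
    using pos shift[of x] by (simp add: \<beta>_def sum_divide_distrib[symmetric])
  have \<beta>c0: "(\<Sum>F\<in>\<F>. \<beta> F * c F) = 1 / 2" using \<beta>c[of 0] by simp
  obtain Fs where Fs: "set Fs = \<F>" "distinct Fs" using finite_distinct_list[OF fin] by blast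
  define L where "L = product_word \<beta> Fs"
  define S where "S = (\<Sum>F\<in>\<F>. (\<beta> F)\<^sup>2)"
  have wf: "word_form (velocities (product_normal n) L) = S"
    using nc(1) by (simp add: L_def product_word(2) sum_list_distinct_conv_sum_set Fs S_def \<F>_def dot_square_norm)
  have "0 < \<beta> F0" using F0 pos by (simp add: \<beta>_def)
  with F0(1) have "0 < S" unfolding S_def by (intro sum_pos2[OF fin]) auto
  have "ehz_capacity (K \<times> K) \<le> ereal (1 / (2 * word_form (velocities (product_normal n) L)))"
  proof (rule ehz_capacity_le_word_form)
    show "finite (\<F> \<times> (UNIV :: bool set))" using fin by simp
    show "K \<times> K = {z. \<forall>i\<in>\<F> \<times> UNIV. product_normal n i \<bullet> z \<le> (c \<circ> fst) i}"
      by (subst (1 2) K) (auto simp: product_normal_def UNIV_bool)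
    fix i assume i: "i \<in> \<F> \<times> (UNIV :: bool set)"
    then have "n (fst i) \<noteq> 0" using nc(1)[of "fst i"] by (auto simp: \<F>_def)
    then show "product_normal n i \<noteq> 0"
      by (simp add: product_normal_def prod_eq_iff[of "n (fst i)"] prod_eq_iff[of "(_, _)"])
    show "product_normal n i \<bullet> (y, y) < (c \<circ> fst) i"
      using i nc(4)[OF _ y, of "fst i"] by (auto simp: product_normal_def \<F>_def)
  next
    show "nonneg_word (\<F> \<times> UNIV) L"
      using \<beta> Fs by (auto simp: nonneg_word_def L_def product_word_def)
    show "sum_list (velocities (product_normal n) L) = 0"
      using \<beta>n by (simp add: L_def product_word(1) sum_list_distinct_conv_sum_set Fs zero_prod_def)
    show "0 < word_form (velocities (product_normal n) L)" using \<open>0 < S\<close> by (simp add: wf)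
    show "cost (c \<circ> fst) L = 1"
      using \<beta>c0 by (simp add: L_def product_word(3) sum_list_distinct_conv_sum_set Fs)
  qed
  also have "\<dots> \<le> ereal (2 * (INF x\<in>K. \<Sum>F | F facet_of K. (infdist x (affine hull F))\<^sup>2))"
  proof -
    \<comment> \<open>The capacity is at most \<open>1 / (2 * S)\<close>, twice this number. By
      Cauchy-Schwarz, the constant value \<open>1 / 2\<close> of the weighted sum of distances
      bounds the sum of their squares from below at every point of \<open>K\<close>.\<close>
    have "1 / (4 * S) \<le> (INF x\<in>K. \<Sum>F\<in>\<F>. (infdist x (affine hull F))\<^sup>2)"
    proof (rule cINF_greatest)
      show "K \<noteq> {}" using \<open>y \<in> K\<close> by blast
      fix x assume "x \<in> K"
      have "(1 / 2)\<^sup>2 \<le> S * (\<Sum>F\<in>\<F>. (c F - n F \<bullet> x)\<^sup>2)"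
        unfolding S_def \<beta>c[of x, symmetric] by (rule Cauchy_Schwarz_ineq_sum)
      also have "\<dots> \<le> S * (\<Sum>F\<in>\<F>. (infdist x (affine hull F))\<^sup>2)"
      \<comment> \<open>Squaring is monotone here because \<open>x\<close> lies in \<open>K\<close>,
        which makes \<open>c F - n F \<bullet> x\<close> non-negative.\<close>
      proof (intro mult_left_mono sum_mono power_mono)
        fix F assume "F \<in> \<F>"
        then have F: "F facet_of K" by (simp add: \<F>_def)
        show "c F - n F \<bullet> x \<le> infdist x (affine hull F)"
          unfolding nc(2)[OF F] by (rule infdist_hyperplane_ge[OF nc(1)[OF F]])
        show "0 \<le> c F - n F \<bullet> x" using \<open>x \<in> K\<close> \<open>F \<in> \<F>\<close> by (subst (asm) K) auto
      qed (use \<open>0 < S\<close> in simp)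
      finally show "1 / (4 * S) \<le> (\<Sum>F\<in>\<F>. (infdist x (affine hull F))\<^sup>2)"
        using \<open>0 < S\<close> by (simp add: field_simps power2_eq_square)
    qed
    then show ?thesis by (simp add: wf \<F>_def)
  qed
  finally show ?thesis .
qed

end
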